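(* For every $k\in\mathbb{N}$, the graph $K_1\vee\Theta(2,2,2k)$ is enumeratively chromatic-choosable.
   Context: $\Theta(l_1,l_2,l_3)$ denotes two end vertices joined by three internally disjoint paths of lengths $l_1,l_2,l_3$; $K_1\vee H$ is the join of $H$ with a single new vertex adjacent to all vertices of $H$. For a list assignment $L$, $P(H,L)$ is the number of proper $L$-colorings; $P(H,m)$ is the chromatic polynomial, and the list color function $P_\ell(H,m)$ is the minimum of $P(H,L)$ over all assignments $L$ of lists of size $m$. A graph $H$ is enumeratively chromatic-choosable if $P_\ell(H,m)=P(H,m)$ for all integers $m\ge\chi(H)$. *)

theory Defs
  imports Main
begin

text \<open>Simple graphs are given by a vertex set V and a symmetric irreflexive
  adjacency relation E (only its restriction to V matters).
  Colours are natural numbers; a list assignment is L :: 'a => nat set.\<close>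

definition simple_graph :: "'a set \<Rightarrow> ('a \<Rightarrow> 'a \<Rightarrow> bool) \<Rightarrow> bool" where
  "simple_graph V E \<longleftrightarrow> finite V \<and> (\<forall>u v. E u v \<longrightarrow> E v u) \<and> (\<forall>v. \<not> E v v)"

text \<open>Proper L-colourings (functions fixed to undefined outside V, so that they are
  counted as colourings of V).\<close>
definition proper_L_colorings ::
  "'a set \<Rightarrow> ('a \<Rightarrow> 'a \<Rightarrow> bool) \<Rightarrow> ('a \<Rightarrow> nat set) \<Rightarrow> ('a \<Rightarrow> nat) set" where
  "proper_L_colorings V E L =
     {f. (\<forall>v\<in>V. f v \<in> L v) \<and> (\<forall>u\<in>V. \<forall>v\<in>V. E u v \<longrightarrow> f u \<noteq> f v)
         \<and> (\<forall>v. v \<notin> V \<longrightarrow> f v = undefined)}"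

definition num_L_colorings :: "'a set \<Rightarrow> ('a \<Rightarrow> 'a \<Rightarrow> bool) \<Rightarrow> ('a \<Rightarrow> nat set) \<Rightarrow> nat" where
  "num_L_colorings V E L = card (proper_L_colorings V E L)"

definition chrom_poly :: "'a set \<Rightarrow> ('a \<Rightarrow> 'a \<Rightarrow> bool) \<Rightarrow> nat \<Rightarrow> nat" where
  "chrom_poly V E m = num_L_colorings V E (\<lambda>_. {0..<m})"

definition chromatic_number :: "'a set \<Rightarrow> ('a \<Rightarrow> 'a \<Rightarrow> bool) \<Rightarrow> nat" where
  "chromatic_number V E = (LEAST m. chrom_poly V E m > 0)"

definition list_color_fn :: "'a set \<Rightarrow> ('a \<Rightarrow> 'a \<Rightarrow> bool) \<Rightarrow> nat \<Rightarrow> nat" where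
  "list_color_fn V E m =
     Inf {num_L_colorings V E L | L. \<forall>v\<in>V. finite (L v) \<and> card (L v) = m}"

definition enum_chrom_choosable :: "'a set \<Rightarrow> ('a \<Rightarrow> 'a \<Rightarrow> bool) \<Rightarrow> bool" where
  "enum_chrom_choosable V E \<longleftrightarrow>
     (\<forall>m::nat. m \<ge> chromatic_number V E \<longrightarrow> list_color_fn V E m = chrom_poly V E m)"

text \<open>Theta graph Theta(l1,l2,l3): end vertices End1, End2, and for path i (i<3) of
  length l_i the internal vertices Inner i j, 1 <= j < l_i.\<close>
datatype theta_vertex = End1 | End2 | Inner nat nat

definition theta_pos :: "nat list \<Rightarrow> nat \<Rightarrow> nat \<Rightarrow> theta_vertex" where
  "theta_pos ls i j = (if j = 0 then End1 else if j = ls ! i then End2 else Inner i j)"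

definition theta_V :: "nat \<Rightarrow> nat \<Rightarrow> nat \<Rightarrow> theta_vertex set" where
  "theta_V l1 l2 l3 = {End1, End2} \<union>
     {Inner i j | i j. i < 3 \<and> 1 \<le> j \<and> j < [l1, l2, l3] ! i}"

definition theta_E :: "nat \<Rightarrow> nat \<Rightarrow> nat \<Rightarrow> theta_vertex \<Rightarrow> theta_vertex \<Rightarrow> bool" where
  "theta_E l1 l2 l3 x y \<longleftrightarrow>
     (\<exists>i<3. \<exists>j. j < [l1, l2, l3] ! i \<and>
        ((x = theta_pos [l1, l2, l3] i j \<and> y = theta_pos [l1, l2, l3] i (Suc j)) \<or>
         (y = theta_pos [l1, l2, l3] i j \<and> x = theta_pos [l1, l2, l3] i (Suc j))))"

definition join_K1_V :: "'a set \<Rightarrow> 'a option set" where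
  "join_K1_V V = insert None (Some ` V)"

definition join_K1_E :: "('a \<Rightarrow> 'a \<Rightarrow> bool) \<Rightarrow> 'a option \<Rightarrow> 'a option \<Rightarrow> bool" where
  "join_K1_E E x y \<longleftrightarrow>
     (x = None \<and> y \<noteq> None) \<or> (x \<noteq> None \<and> y = None) \<or>
     (\<exists>a b. x = Some a \<and> y = Some b \<and> E a b)"

end

theory Submission
  imports Defs
begin

text \<open>
  Deleting the colour \<open>c\<close> of the dominating vertex from all lists, one sums the numbers of
  colourings of \<open>\<Theta>(2,2,2k)\<close> over all \<open>c\<close>. For \<open>m \<ge> 4\<close> it suffices that for \<open>q = m - 1 \<ge> 3\<close>
  constant lists of size \<open>q\<close> minimise the number of colourings of \<open>\<Theta>(2,2,2k)\<close>. Fixing the colours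
  \<open>(a, b)\<close> of the two ends, this number is a sum of products of three path counts. If the ends have
  equal lists, the diagonal \<open>a = b\<close> is controlled by list colourings of an even cycle; if the lists
  differ, every factor exceeds its minimum so often that the sum is larger.

  For \<open>m = 3\<close> this fails: with lists of size two, \<open>\<Theta>(2,2,2k)\<close> with \<open>k \<ge> 2\<close> may have a single
  colouring although \<open>P(\<Theta>, 2) = 2\<close>. The assignments with a single colouring are so restricted that
  every colour is missing from some list, and all colours but one are missing from two lists. Hence
  if deleting \<open>c\<close> leaves a single colouring, then deleting the other two colours of the dominating
  vertex leaves lists of size three at one vertex and at two vertices, respectively, which gives at
  least two and three colourings, and \<open>1 + 2 + 3 = 6 = P(K\<^sub>1 \<or> \<Theta>, 3)\<close>.
\<close>

subsection \<open>Paths and cycles\<close>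

text \<open>The number of ways to colour the inner vertices of a path from the lists \<open>Vs\<close> when its ends
  have the colours \<open>a\<close> and \<open>b\<close>.\<close>


fun path_count :: "nat set list \<Rightarrow> nat \<Rightarrow> nat \<Rightarrow> nat" where
  "path_count [] a b = (if a = b then 0 else 1)"
| "path_count (V # Vs) a b = (\<Sum>c\<in>V - {a}. path_count Vs c b)"

definition q_lists :: "nat \<Rightarrow> nat set list \<Rightarrow> bool" where
  "q_lists q Vs \<longleftrightarrow> (\<forall>V\<in>set Vs. finite V \<and> card V = q)"

lemma q_lists_simps [simp]:
  "q_lists q []"
  "q_lists q (V # Vs) \<longleftrightarrow> finite V \<and> card V = q \<and> q_lists q Vs"
  "q_lists q (Us @ Vs) \<longleftrightarrow> q_lists q Us \<and> q_lists q Vs"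
  by (auto simp: q_lists_def)

lemma path_count_append:
  "path_count (Us @ V # Vs) a b = (\<Sum>c\<in>V. path_count Us a c * path_count Vs c b)" 
  if "finite V"
proof (induction Us arbitrary: a)
  case Nil
  have "(\<Sum>c\<in>V. path_count [] a c * path_count Vs c b)
      = (\<Sum>c\<in>V - {a}. path_count [] a c * path_count Vs c b)"
    by (rule sum.mono_neutral_right) (use that in auto)
  also have "\<dots> = (\<Sum>c\<in>V - {a}. path_count Vs c b)"
    by (rule sum.cong) auto
  finally show ?case by simp
next
  case (Cons U Us)
  have "path_count ((U # Us) @ V # Vs) a b
      = (\<Sum>d\<in>U - {a}. \<Sum>c\<in>V. path_count Us d c * path_count Vs c b)"
    using Cons by simp
  also have "\<dots> = (\<Sum>c\<in>V. \<Sum>d\<in>U - {a}. path_count Us d c * path_count Vs c b)"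
    by (rule sum.swap)
  finally show ?case by (simp add: sum_distrib_right)
qed

text \<open>Both sides count the list colourings of one cycle with lists \<open>A\<close>,
  \<open>Us\<close>, \<open>U\<close>, \<open>Vs\<close>; only the vertex at which the cycle is cut
  open differs.\<close>

lemma path_count_rotate:
  assumes "finite A" "finite U"
  shows "(\<Sum>a\<in>A. path_count (Us @ U # Vs) a a) = (\<Sum>u\<in>U. path_count (Vs @ A # Us) u u)"
proof -
  have "(\<Sum>a\<in>A. path_count (Us @ U # Vs) a a)
      = (\<Sum>a\<in>A. \<Sum>u\<in>U. path_count Vs u a * path_count Us a u)"
    using assms by (simp add: path_count_append mult.commute)
  also have "\<dots> = (\<Sum>u\<in>U. \<Sum>a\<in>A. path_count Vs u a * path_count Us a u)"
    by (rule sum.swap)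
  finally show ?thesis using assms by (simp add: path_count_append)
qed

text \<open>The colour excluded at the first vertex is added back on the left, which keeps the later
  identities free of truncated subtraction.\<close>

lemma path_count_Cons_add:
  assumes "finite V"
  shows "path_count (V # Vs) a b + (if a \<in> V then path_count Vs a b else 0)
    = (\<Sum>c\<in>V. path_count Vs c b)"
  using assms by (cases "a \<in> V") (simp_all add: sum.remove)

lemma sum_path_count_Cons:
  assumes "finite U" "finite V"
  shows "(\<Sum>c\<in>U. path_count (V # Vs) c b) + (\<Sum>c\<in>U \<inter> V. path_count Vs c b)
    = card U * (\<Sum>c\<in>V. path_count Vs c b)"
proof -
  have "(\<Sum>c\<in>U \<inter> V. path_count Vs c b) = (\<Sum>c\<in>U. if c \<in> V then path_count Vs c b else 0)"
    using assms by (simp add: sum.inter_restrict)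
  then have "(\<Sum>c\<in>U. path_count (V # Vs) c b) + (\<Sum>c\<in>U \<inter> V. path_count Vs c b)
     = (\<Sum>c\<in>U. path_count (V # Vs) c b + (if c \<in> V then path_count Vs c b else 0))"
    by (simp only: sum.distrib)
  also have "\<dots> = card U * (\<Sum>c\<in>V. path_count Vs c b)"
    using assms by (simp only: path_count_Cons_add) simp
  finally show ?thesis .
qed

text \<open>Colour greedily from the end coloured \<open>b\<close> towards the free vertex with list
  \<open>V\<close>: each list of size \<open>Suc p\<close> loses at most the colour of the neighbour
  chosen before.\<close>

lemma sum_path_count_ge:
  assumes "q_lists (Suc p) (V # Vs)"
  shows "p ^ Suc (length Vs) \<le> (\<Sum>c\<in>V. path_count Vs c b)"
  using assms
proof (induction Vs arbitrary: V)
  case Nil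
  have "card (V - {b}) \<le> (\<Sum>c\<in>V. path_count [] c b)"
  proof -
    have "(\<Sum>c\<in>V - {b}. path_count [] c b) \<le> (\<Sum>c\<in>V. path_count [] c b)"
      using Nil by (intro sum_mono2) auto
    moreover have "(\<Sum>c\<in>V - {b}. path_count [] c b) = (\<Sum>c\<in>V - {b}. 1)"
      by (rule sum.cong) auto
    ultimately show ?thesis by simp
  qed
  moreover have "p \<le> card (V - {b})"
    using Nil by (auto simp: card_Diff_singleton_if)
  ultimately show ?case by simp
next
  case (Cons W Ws)
  let ?T = "\<Sum>c\<in>W. path_count Ws c b"
  have "p ^ Suc (length Ws) \<le> ?T" using Cons by auto
  moreover have "(\<Sum>c\<in>V \<inter> W. path_count Ws c b) \<le> ?T"
    using Cons by (intro sum_mono2) auto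
  moreover have "(\<Sum>c\<in>V. path_count (W # Ws) c b) + (\<Sum>c\<in>V \<inter> W. path_count Ws c b) = Suc p * ?T"
    using sum_path_count_Cons[of V W Ws b] Cons.prems by auto
  \<comment> \<open>The overlap on \<open>V \<inter> W\<close> costs at most one of the
    \<open>Suc p\<close> copies of \<open>?T\<close>.\<close>
  ultimately have "p * ?T \<le> (\<Sum>c\<in>V. path_count (W # Ws) c b)" by simp
  moreover have "p * p ^ Suc (length Ws) \<le> p * ?T"
    using \<open>p ^ Suc (length Ws) \<le> ?T\<close> by (rule mult_le_mono2)
  ultimately show ?case unfolding power_Suc length_Cons by (rule order_trans[rotated])
qed

text \<open>A colour \<open>c\<close> of \<open>V\<close> can follow every colour of
  \<open>U - {a}\<close> except itself. These are \<open>r\<close> colours in general, and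
  \<open>r + 1\<close> if \<open>c\<close> is outside \<open>U\<close> or equals \<open>a\<close>;
  the last two summands collect this surplus.\<close>

lemma path_count_Cons_Cons:
  assumes "finite U" "finite V" "card U = r + 2" "card V = r + 2" "a \<in> U"
  shows "path_count (U # V # Vs) a b = r * (\<Sum>c\<in>V. path_count Vs c b)
    + (\<Sum>c\<in>V - U. path_count Vs c b) + (if a \<in> V then path_count Vs a b else 0)"
proof -
  let ?T = "\<Sum>c\<in>V. path_count Vs c b"
  have 1: "path_count (U # V # Vs) a b + path_count (V # Vs) a b
    = (\<Sum>c\<in>U. path_count (V # Vs) c b)"
    using path_count_Cons_add[of U "V # Vs" a b] assms by simp
  have 2: "path_count (V # Vs) a b + (if a \<in> V then path_count Vs a b else 0) = ?T"
    using path_count_Cons_add assms by blast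
  have 3: "(\<Sum>c\<in>U. path_count (V # Vs) c b) + (\<Sum>c\<in>U \<inter> V. path_count Vs c b) = (r + 2) * ?T"
    using sum_path_count_Cons[of U V Vs b] assms by simp
  have 4: "?T = (\<Sum>c\<in>V - U. path_count Vs c b) + (\<Sum>c\<in>U \<inter> V. path_count Vs c b)"
    using sum.subset_diff[of "U \<inter> V" V] assms by (simp add: Diff_Int_distrib2 Diff_Int)
  show ?thesis using 1 2 3 4 by (auto simp: algebra_simps)
qed

text \<open>The value of \<open>path_count\<close> for a path of length \<open>2 k\<close> with \<open>r + 2\<close> colours and different
  colours at the ends.\<close>

fun even_path_poly :: "nat \<Rightarrow> nat \<Rightarrow> nat" where
  "even_path_poly r 0 = 0"
| "even_path_poly r (Suc k) = r * (r + 1) ^ (2 * k) + even_path_poly r k"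

text \<open>The closed form \<open>((r + 1) ^ (2 * k) - 1) / (r + 2)\<close> without division. For
  constant lists it sums the path counts over all start colours, exactly one of which equals the
  colour of the other end.\<close>

lemma even_path_poly_eq: "(r + 2) * even_path_poly r k + 1 = (r + 1) ^ (2 * k)"
  by (induction k) (auto simp: algebra_simps power2_eq_square)

lemma even_path_poly_le: "even_path_poly r k \<le> (r + 1) ^ (2 * k - 1)"
proof (cases k)
  case (Suc j)
  have "even_path_poly r j \<le> (r + 1) ^ (2 * j)"
    using even_path_poly_eq[of r j] by simp
  then show ?thesis using Suc by simp
qed simp

section \<open>Paths of even length: the lower bound and its attainment by constant lists\<close>

lemma card_Diff_doubleton:
  "card (V - {a, b :: nat}) = (\<Sum>c\<in>V - {a}. if c = b then 0 else 1)" if "finite V"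
proof -
  have "(\<Sum>c\<in>V - {a}. if c = b then 0 else 1) = (\<Sum>c\<in>V - {a, b}. if c = b then 0 else 1 :: nat)"
    by (rule sum.mono_neutral_right) (use that in auto)
  also have "\<dots> = (\<Sum>c\<in>V - {a, b}. 1)" by (rule sum.cong) auto
  finally show ?thesis by simp
qed

lemma path_count_single: "finite V \<Longrightarrow> path_count [V] a b = card (V - {a, b})"
  by (simp add: card_Diff_doubleton)

lemma card_Diff_doubleton_ge:
  fixes V :: "nat set"
  assumes "finite V" "card V = r + 2"
  shows "r \<le> card (V - {a, b})" "r + 1 \<le> card (V - {a, a})"
proof -
  have "card V - card {a, b} \<le> card (V - {a, b})" by (rule diff_card_le_card_Diff) simp
  moreover have "card {a, b} \<le> 2" by (simp add: card_insert_if)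
  ultimately show "r \<le> card (V - {a, b})" using assms by linarith
  show "r + 1 \<le> card (V - {a, a})" using assms by (simp add: card_Diff_singleton_if)
qed

text \<open>Peel off two lists at a time. If \<open>a\<close> is missing from the first list
  \<open>U\<close>, nothing is lost there and the bound with a free start suffices. Otherwise the
  two-step recursion gives \<open>r\<close> times that bound plus a surplus containing at least one
  shorter path count: the one from \<open>a\<close> if \<open>a\<close> is in \<open>V\<close>, else
  one from some colour of \<open>V - U\<close>, which exists because the lists have equal
  size.\<close>

lemma path_count_ge:
  assumes "q_lists (r + 2) Vs" "length Vs + 1 = 2 * k"
  shows "even_path_poly r k \<le> path_count Vs a b"
  using assms
proof (induction k arbitrary: Vs a)
  case (Suc k)
  show ?case
  proof (cases "k = 0")
    case True
    then obtain V where V: "Vs = [V]" using Suc.prems by (auto simp: length_Suc_conv)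
    then show ?thesis using True Suc.prems card_Diff_doubleton_ge(1)[of V r a b]
      by (simp add: path_count_single del: path_count.simps)
  next
    case False
    then obtain U V Ws where Vs: "Vs = U # V # Ws" and len: "length Ws + 1 = 2 * k"
      using Suc.prems by (cases Vs; cases "tl Vs") auto
    have qU: "finite U" "card U = r + 2" and qV: "finite V" "card V = r + 2"
      and qW: "q_lists (r + 2) Ws"
      using Suc.prems Vs by auto
    show ?thesis
    proof (cases "a \<in> U")
      case False
      then have "path_count Vs a b = (\<Sum>c\<in>U. path_count (V # Ws) c b)"
        using path_count_Cons_add[of U "V # Ws" a b] qU Vs by simp
      moreover have "(r + 1) ^ (2 * Suc k - 1) \<le> (\<Sum>c\<in>U. path_count (V # Ws) c b)"
        using sum_path_count_ge[of "r + 1" U "V # Ws" b] Suc.prems Vs len[symmetric] by simp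
      ultimately show ?thesis using even_path_poly_le[of r "Suc k"] by linarith
    next
      case True
      have T: "(r + 1) ^ (2 * k) \<le> (\<Sum>c\<in>V. path_count Ws c b)"
        using sum_path_count_ge[of "r + 1" V Ws b] Suc.prems Vs len[symmetric] by simp
      have "even_path_poly r k \<le> (\<Sum>c\<in>V - U. path_count Ws c b) + (if a \<in> V then path_count Ws a b else 0)"
      proof (cases "a \<in> V")
        case False
        then have "U \<noteq> V" using True by auto
        then have "\<not> V \<subseteq> U" using qU qV card_subset_eq by metis
        then obtain c where c: "c \<in> V - U" by auto
        then have "path_count Ws c b \<le> (\<Sum>c\<in>V - U. path_count Ws c b)"
          using qV by (intro member_le_sum) auto
        then show ?thesis using Suc.IH[OF qW len, of c] by linarith
      qed (use Suc.IH[OF qW len, of a] in simp)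
      then show ?thesis
        unfolding Vs path_count_Cons_Cons[OF qU(1) qV(1) qU(2) qV(2) True] even_path_poly.simps
        using mult_le_mono2[OF T, of r] by linarith
    qed
  qed
qed simp

text \<open>With equal lists the surplus in the two-step recursion is only the term for
  \<open>a\<close>, and the sum over \<open>V\<close> is \<open>(r + 1) ^ (2 * k)\<close> by the
  closed form.\<close>

lemma path_count_replicate:
  assumes "finite V" "card V = r + 2" "a \<in> V" "b \<in> V" "k \<ge> 1"
  shows "path_count (replicate (2 * k - 1) V) a b
    = even_path_poly r k + (if a = b then 1 else 0)"
  using assms(5,3)
proof (induction k arbitrary: a rule: dec_induct)
  case base
  then show ?case using assms
    by (simp add: path_count_single card_Diff_singleton_if card_Diff_subset del: path_count.simps)
next
  case (step k)
  have "replicate (2 * Suc k - 1) V = V # V # replicate (2 * k - 1) V"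
    using step.hyps by (cases k) auto
  moreover have "(\<Sum>c\<in>V. path_count (replicate (2 * k - 1) V) c b) = (r + 1) ^ (2 * k)"
  proof -
    have "(\<Sum>c\<in>V. path_count (replicate (2 * k - 1) V) c b)
        = (\<Sum>c\<in>V. even_path_poly r k + (if c = b then 1 else 0))"
      by (rule sum.cong) (use step in auto)
    also have "\<dots> = (r + 2) * even_path_poly r k + 1"
      using assms by (simp add: sum.distrib)
    finally show ?thesis by (simp only: even_path_poly_eq)
  qed
  ultimately show ?case
    using path_count_Cons_Cons[of V V r a "replicate (2 * k - 1) V" b] assms step
    by simp
qed

section \<open>List colourings of even cycles\<close>

lemma consecutive_neq:
  assumes "\<exists>V\<in>set Vs. V \<noteq> A"
  shows "\<exists>Us U V Ws. A # Vs = Us @ U # V # Ws \<and> U \<noteq> V"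
  using assms
proof (induction Vs arbitrary: A)
  case (Cons V Vs)
  show ?case
  proof (cases "V = A")
    case True
    then obtain Us U W Ws where "V # Vs = Us @ U # W # Ws \<and> U \<noteq> W"
      using Cons.IH[of V] Cons.prems by auto
    then have "A # V # Vs = (A # Us) @ U # W # Ws \<and> U \<noteq> W" by simp
    then show ?thesis by blast
  next
    case False
    then have "A # V # Vs = [] @ A # V # Vs \<and> A \<noteq> V" by simp
    then show ?thesis by blast
  qed
qed simp

text \<open>The slack needed for cycles: a start colour with \<open>(r + 1) ^ (2 * k - 1)\<close>
  extensions pays for its own share \<open>even_path_poly r k\<close> and for the
  \<open>r + 2\<close> extra colourings that constant lists have.\<close>

lemma even_path_poly_add_le:
  assumes "r \<ge> 1" "k \<ge> 2"
  shows "even_path_poly r k + r + 2 \<le> (r + 1) ^ (2 * k - 1)"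
proof -
  obtain j where k: "k = Suc j" "j \<ge> 1" using assms by (cases k) auto
  have "even_path_poly r j \<ge> 1"
    using k assms one_less_power[of "r + 1" "2 * j"]
    by (simp flip: even_path_poly_eq del: One_nat_def)
  then have "even_path_poly r j + r + 2 \<le> (r + 2) * even_path_poly r j + 1"
    using mult_le_mono2[of 1 "even_path_poly r j" "r + 1"] by simp
  then show ?thesis using k even_path_poly_eq[of r j] by simp
qed

text \<open>If two neighbouring lists of the cycle differ, we rotate them to the front. A colour of the
  first list that is absent from the second then loses nothing, which outweighs the missing
  contribution of all other colours.\<close>

lemma cycle_count_ge:
  assumes "q_lists (r + 2) (A # Vs)" "length Vs + 1 = 2 * k" "r \<ge> 1"
  shows "(r + 2) * (even_path_poly r k + 1) \<le> (\<Sum>a\<in>A. path_count Vs a a)"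
proof -
  have k: "k \<ge> 1" using assms(2) by simp
  have A: "finite A" "card A = r + 2" using assms(1) by auto
  consider (all) "\<forall>V\<in>set Vs. V = A" | (one) "k = 1" | (diff) "k \<ge> 2" "\<exists>V\<in>set Vs. V \<noteq> A"
    using k by (cases "k = 1") auto
  then show ?thesis
  proof cases
    case all
    then have "Vs = replicate (2 * k - 1) A"
      using assms(2) by (metis add_diff_cancel_right' replicate_length_same)
    then have "(\<Sum>a\<in>A. path_count Vs a a) = (\<Sum>a\<in>A. even_path_poly r k + 1)"
      using path_count_replicate[OF A _ _ k] by (intro sum.cong) auto
    then show ?thesis using A by simp
  next
    case one
    \<comment> \<open>The slack estimate fails for \<open>k = 1\<close>, but there every start
      colour has at least \<open>r + 1 = even_path_poly r 1 + 1\<close> extensions, whatever the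
      lists.\<close>
    then obtain V where V: "Vs = [V]" using assms(2) by (auto simp: length_Suc_conv)
    then have "r + 1 \<le> path_count Vs a a" for a
      using card_Diff_doubleton_ge(2)[of V r a] assms(1)
      by (simp add: path_count_single del: path_count.simps)
    then have "(\<Sum>a\<in>A. r + 1) \<le> (\<Sum>a\<in>A. path_count Vs a a)" by (intro sum_mono)
    then show ?thesis using one A by simp
  next
    case diff
    obtain Us U V Ws where s: "A # Vs = Us @ U # V # Ws" and ne: "U \<noteq> V"
      using consecutive_neq[OF diff(2)] by blast
    have UV: "finite U" "card U = r + 2" "finite V" "card V = r + 2"
      using assms(1) unfolding s by auto
    have rot: "(\<Sum>a\<in>A. path_count Vs a a) = (\<Sum>u\<in>U. path_count (V # Ws @ Us) u u)"
    proof (cases Us)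
      case Nil
      then show ?thesis using s by simp
    next
      case (Cons A' Us')
      then show ?thesis using s path_count_rotate[of A U Us' "V # Ws"] A UV by simp
    qed
    have len: "length (V # Ws @ Us) + 1 = 2 * k"
      using arg_cong[OF s, of length] assms(2) by simp
    have ql: "q_lists (r + 2) (V # Ws @ Us)" using assms(1) unfolding s by auto
    have "\<not> U \<subseteq> V" using ne UV card_subset_eq by metis
    then obtain u where u: "u \<in> U" "u \<notin> V" by auto
    have "path_count (V # Ws @ Us) u u = (\<Sum>c\<in>V. path_count (Ws @ Us) c u)"
      using u by simp
    then have big: "(r + 1) ^ (2 * k - 1) \<le> path_count (V # Ws @ Us) u u"
      using sum_path_count_ge[of "r + 1" V "Ws @ Us" u] ql len[symmetric] by simp
    have "(\<Sum>v\<in>U - {u}. even_path_poly r k) \<le> (\<Sum>v\<in>U - {u}. path_count (V # Ws @ Us) v v)"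
      using path_count_ge[OF ql len] by (intro sum_mono)
    moreover have "card (U - {u}) = r + 1" using u UV by simp
    ultimately have "(r + 1) * even_path_poly r k \<le> (\<Sum>v\<in>U - {u}. path_count (V # Ws @ Us) v v)"
      by simp
    moreover have "(\<Sum>v\<in>U. path_count (V # Ws @ Us) v v)
        = path_count (V # Ws @ Us) u u + (\<Sum>v\<in>U - {u}. path_count (V # Ws @ Us) v v)"
      using u UV by (simp only: sum.remove)
    ultimately show ?thesis
      using big even_path_poly_add_le[OF assms(3) diff(1)] rot by (simp del: path_count.simps)
  qed
qed


subsection \<open>Theta graphs with lists of size at least three\<close>

text \<open>\<open>A\<close>, \<open>B\<close> are the lists of the ends, \<open>L\<close>, \<open>M\<close> those of the middle vertices of the two short
  paths, and \<open>N\<close> counts the colourings of the long path.\<close>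

definition theta_count ::
  "nat set \<Rightarrow> nat set \<Rightarrow> nat set \<Rightarrow> nat set \<Rightarrow> (nat \<Rightarrow> nat \<Rightarrow> nat) \<Rightarrow> nat" where
  "theta_count A B L M N = (\<Sum>a\<in>A. \<Sum>b\<in>B. card (L - {a, b}) * card (M - {a, b}) * N a b)"

text \<open>The chromatic polynomial of Theta(2,2,2k) at \<open>r + 2\<close> for
  \<open>k \<ge> 1\<close>; the first summand has equal colours at the ends, the second different
  ones.\<close>

definition theta_poly :: "nat \<Rightarrow> nat \<Rightarrow> nat" where
  "theta_poly r k = (r + 2) * (r + 1)\<^sup>2 * (even_path_poly r k + 1)
     + (r + 2) * (r + 1) * r\<^sup>2 * even_path_poly r k"

lemma theta_count_const:
  assumes "finite V" "card V = r + 2" "k \<ge> 1"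
  shows "theta_count V V V V (path_count (replicate (2 * k - 1) V)) = theta_poly r k"
proof -
  let ?N = "path_count (replicate (2 * k - 1) V)"
  have "(\<Sum>b\<in>V. card (V - {a, b}) * card (V - {a, b}) * ?N a b)
      = (r + 1)\<^sup>2 * (even_path_poly r k + 1) + (r + 1) * (r\<^sup>2 * even_path_poly r k)" if a: "a \<in> V" for a
  proof -
    have "(\<Sum>b\<in>V. card (V - {a, b}) * card (V - {a, b}) * ?N a b)
        = card (V - {a, a}) * card (V - {a, a}) * ?N a a
          + (\<Sum>b\<in>V - {a}. card (V - {a, b}) * card (V - {a, b}) * ?N a b)"
      using assms(1) a by (rule sum.remove)
    also have "(\<Sum>b\<in>V - {a}. card (V - {a, b}) * card (V - {a, b}) * ?N a b)
        = (\<Sum>b\<in>V - {a}. r\<^sup>2 * even_path_poly r k)"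
    proof (rule sum.cong)
      fix b assume "b \<in> V - {a}"
      then have "card (V - {a, b}) = r" using assms a by (simp add: card_Diff_subset)
      then show "card (V - {a, b}) * card (V - {a, b}) * ?N a b = r\<^sup>2 * even_path_poly r k"
        using path_count_replicate[OF assms(1,2) a, of b k] assms(3) \<open>b \<in> V - {a}\<close>
        by (simp add: power2_eq_square)
    qed simp
    finally show ?thesis
      using path_count_replicate[OF assms(1,2) a a assms(3)] assms a
      by (simp add: power2_eq_square)
  qed
  then have "theta_count V V V V ?N
     = (\<Sum>a\<in>V. (r + 1)\<^sup>2 * (even_path_poly r k + 1) + (r + 1) * (r\<^sup>2 * even_path_poly r k))"
    unfolding theta_count_def by (intro sum.cong) auto
  then show ?thesis using assms by (simp add: theta_poly_def algebra_simps)
qed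

text \<open>Sum over the middle colour \<open>c\<close> first: it is compatible with
  \<open>card (A - {c}) * card (B - {c})\<close> end pairs. This is at least
  \<open>(r + 2) * (r + 1)\<close>, except that \<open>r + 1\<close> pairs may be lacking when
  \<open>c\<close> lies in both \<open>A\<close> and \<open>B\<close>.\<close>

lemma sum_card_Diff_ge:
  fixes A B L :: "nat set"
  assumes "finite A" "finite B" "finite L" "card A = r + 2" "card B = r + 2" "card L = r + 2"
  shows "(r + 2)\<^sup>2 * (r + 1) \<le> (\<Sum>a\<in>A. \<Sum>b\<in>B. card (L - {a, b})) + (r + 1) * card (A \<inter> B)"
proof -
  have "(\<Sum>a\<in>A. \<Sum>b\<in>B. card (L - {a, b}))
      = (\<Sum>a\<in>A. \<Sum>b\<in>B. \<Sum>c\<in>L. of_bool (c \<noteq> a) * of_bool (c \<noteq> b))"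
  proof (intro sum.cong refl)
    fix a b
    have "L - {a, b} = L \<inter> {c. c \<noteq> a \<and> c \<noteq> b}" by auto
    then have "card (L - {a, b}) = (\<Sum>c\<in>L. of_bool (c \<noteq> a \<and> c \<noteq> b))"
      using assms(3) by (simp add: sum.inter_restrict[symmetric])
    then show "card (L - {a, b}) = (\<Sum>c\<in>L. of_bool (c \<noteq> a) * of_bool (c \<noteq> b))"
      by (simp add: of_bool_conj)
  qed
  also have "\<dots> = (\<Sum>c\<in>L. \<Sum>a\<in>A. \<Sum>b\<in>B. of_bool (c \<noteq> a) * of_bool (c \<noteq> b))"
    by (subst (2) sum.swap, subst sum.swap) simp
  also have "\<dots> = (\<Sum>c\<in>L. card (A - {c}) * card (B - {c}))"
  proof (intro sum.cong refl)
    fix c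
    have "card (X - {c}) = (\<Sum>a\<in>X. of_bool (c \<noteq> a))" if "finite X" for X :: "nat set"
    proof -
      have "X - {c} = X \<inter> {a. c \<noteq> a}" by auto
      then show ?thesis using that by (simp add: sum.inter_restrict[symmetric])
    qed
    then show "(\<Sum>a\<in>A. \<Sum>b\<in>B. of_bool (c \<noteq> a) * of_bool (c \<noteq> b)) = card (A - {c}) * card (B - {c})"
      using assms by (simp only: sum_product)
  qed
  finally have eq: "(\<Sum>a\<in>A. \<Sum>b\<in>B. card (L - {a, b})) = (\<Sum>c\<in>L. card (A - {c}) * card (B - {c}))" .
  have "(\<Sum>c\<in>L. (r + 2) * (r + 1))
      \<le> (\<Sum>c\<in>L. card (A - {c}) * card (B - {c}) + (r + 1) * of_bool (c \<in> A \<inter> B))"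
    using assms by (intro sum_mono) (auto simp: card_Diff_singleton_if)
  also have "\<dots> = (\<Sum>a\<in>A. \<Sum>b\<in>B. card (L - {a, b})) + (r + 1) * card (L \<inter> (A \<inter> B))"
    using assms(3) by (simp add: eq sum.distrib sum_distrib_left[symmetric] Int_def)
  also have "\<dots> \<le> (\<Sum>a\<in>A. \<Sum>b\<in>B. card (L - {a, b})) + (r + 1) * card (A \<inter> B)"
    using assms by (intro add_left_mono mult_le_mono2 card_mono) auto
  finally show ?thesis using assms by (simp add: power2_eq_square algebra_simps)
qed

lemma sum_excess:
  fixes f :: "nat \<Rightarrow> nat \<Rightarrow> nat"
  assumes "\<And>a b. c \<le> f a b"
  shows "(\<Sum>a\<in>A. \<Sum>b\<in>B. f a b) = (\<Sum>a\<in>A. \<Sum>b\<in>B. f a b - c) + card A * card B * c"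
proof -
  have "(\<Sum>a\<in>A. \<Sum>b\<in>B. f a b) = (\<Sum>a\<in>A. \<Sum>b\<in>B. (f a b - c) + c)"
    using assms by simp
  then show ?thesis by (simp only: sum.distrib) simp
qed

lemma sum_of_bool_diagonal:
  fixes A B :: "nat set"
  assumes "finite A" "finite B"
  shows "(\<Sum>a\<in>A. \<Sum>b\<in>B. of_bool (a = b)) = card (A \<inter> B)"
proof -
  have "(\<Sum>b\<in>B. of_bool (a = b)) = (of_bool (a \<in> B) :: nat)" for a
    using assms by (simp add: of_bool_def)
  then show ?thesis using assms by simp
qed

text \<open>On the diagonal each middle vertex has at least \<open>r + 1\<close> choices, and what
  remains is the cycle obtained from the long path by identifying its ends. Off the diagonal each of
  the three factors is bounded by its own minimum.\<close>

lemma theta_count_same_ends: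
  assumes "q_lists (r + 2) (A # L # M # Vs)" "length Vs + 1 = 2 * k" "r \<ge> 1"
  shows "theta_poly r k \<le> theta_count A A L M (path_count Vs)"
proof -
  let ?t = "\<lambda>a b. card (L - {a, b}) * card (M - {a, b}) * path_count Vs a b"
  have "(r + 1)\<^sup>2 * path_count Vs a a + (r + 1) * (r\<^sup>2 * even_path_poly r k) \<le> (\<Sum>b\<in>A. ?t a b)"
    if "a \<in> A" for a
  proof -
    have "(\<Sum>b\<in>A. ?t a b) = ?t a a + (\<Sum>b\<in>A - {a}. ?t a b)"
      using assms(1) that by (intro sum.remove) auto
    moreover have "(r + 1)\<^sup>2 * path_count Vs a a \<le> ?t a a"
      unfolding power2_eq_square using assms(1) card_Diff_doubleton_ge(2)
      by (intro mult_le_mono) auto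
    moreover have "(\<Sum>b\<in>A - {a}. r\<^sup>2 * even_path_poly r k) \<le> (\<Sum>b\<in>A - {a}. ?t a b)"
      unfolding power2_eq_square using assms(1) card_Diff_doubleton_ge(1) path_count_ge[OF _ assms(2)]
      by (intro sum_mono mult_le_mono) auto
    moreover have "(\<Sum>b\<in>A - {a}. r\<^sup>2 * even_path_poly r k) = (r + 1) * (r\<^sup>2 * even_path_poly r k)"
      using assms(1) that by simp
    ultimately show ?thesis by linarith
  qed
  then have "(\<Sum>a\<in>A. (r + 1)\<^sup>2 * path_count Vs a a + (r + 1) * (r\<^sup>2 * even_path_poly r k))
      \<le> theta_count A A L M (path_count Vs)"
    unfolding theta_count_def by (intro sum_mono) auto
  moreover have "(\<Sum>a\<in>A. (r + 1)\<^sup>2 * path_count Vs a a + (r + 1) * (r\<^sup>2 * even_path_poly r k))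
     = (r + 1)\<^sup>2 * (\<Sum>a\<in>A. path_count Vs a a) + (r + 2) * ((r + 1) * (r\<^sup>2 * even_path_poly r k))"
    using assms(1) by (simp add: sum.distrib sum_distrib_left)
  moreover have "(r + 1)\<^sup>2 * ((r + 2) * (even_path_poly r k + 1)) \<le> (r + 1)\<^sup>2 * (\<Sum>a\<in>A. path_count Vs a a)"
    using cycle_count_ge[of r A Vs k] assms by (intro mult_le_mono2) auto
  ultimately show ?thesis by (simp add: theta_poly_def algebra_simps)
qed

text \<open>The arithmetic for different end lists: \<open>D\<close> is
  \<open>even_path_poly r k\<close>, \<open>t\<close> is the size of \<open>A \<inter> B\<close>,
  and \<open>S1\<close>, \<open>S2\<close>, \<open>S3\<close> are the total excesses of the three
  factors over \<open>r\<close>, \<open>r\<close> and \<open>D\<close>. A smaller \<open>t\<close>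
  costs diagonal terms but raises \<open>S1\<close> and \<open>S2\<close> by more.\<close>

lemma theta_ineq:
  fixes r D t S1 S2 S3 T :: nat
  assumes "r \<ge> 1" "t \<le> r + 1" "(r + 2)\<^sup>2 \<le> S1 + (r + 1) * t" "(r + 2)\<^sup>2 \<le> S2 + (r + 1) * t"
    and "r + 2 \<le> S3" "D \<ge> 3 \<or> (r \<ge> 2 \<and> D \<ge> 2)"
    and "(r + 2)\<^sup>2 * (D * r\<^sup>2) + D * r * (S1 + S2) + D * t + r\<^sup>2 * S3 \<le> T"
  shows "(r + 2) * (r + 1)\<^sup>2 * (D + 1) + (r + 2) * (r + 1) * r\<^sup>2 * D \<le> T"
proof -
  obtain u where u: "r + 1 = t + u" using assms(2) le_Suc_ex by blast
  have S: "2 * r + 3 + (r + 1) * u \<le> S" if "(r + 2)\<^sup>2 \<le> S + (r + 1) * t" for S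
  proof -
    have "(r + 1) * (r + 1) = (r + 1) * t + (r + 1) * u" using u by (simp add: algebra_simps)
    then show ?thesis using that by (simp add: power2_eq_square algebra_simps)
  qed
  \<comment> \<open>What remains for \<open>u = 0\<close> after cancelling common terms. For
    \<open>r = 1\<close> it reads \<open>9 + D \<le> 4 * D\<close>, hence the demand
    \<open>D \<ge> 3\<close>; for \<open>r \<ge> 2\<close> the value \<open>D = 2\<close> is
    enough.\<close>
  have c: "2 * r\<^sup>2 + 5 * r + 2 + D \<le> D * (2 * r\<^sup>2 + 2 * r)"
  proof (cases "D \<ge> 3")
    case True
    then obtain e where e: "D = 3 + e" using le_Suc_ex by blast
    obtain s where s: "r = 1 + s" using assms(1) le_Suc_ex by blast
    show ?thesis unfolding e s by (simp add: algebra_simps power2_eq_square)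
  next
    case False
    then have D: "D = 2" and "r \<ge> 2" using assms(6) by auto
    then obtain s where s: "r = 2 + s" using le_Suc_ex by blast
    show ?thesis unfolding D s by (simp add: algebra_simps power2_eq_square)
  qed
  have du: "D * u \<le> D * (2 * r * (r + 1) * u)"
    using assms(1) by (intro mult_le_mono2) auto
  have "D * r * ((2 * r + 3 + (r + 1) * u) + (2 * r + 3 + (r + 1) * u)) \<le> D * r * (S1 + S2)"
    using S[OF assms(3)] S[OF assms(4)] by (intro mult_le_mono2 add_mono)
  moreover have "r\<^sup>2 * (r + 2) \<le> r\<^sup>2 * S3" using assms(5) by (rule mult_le_mono2)
  ultimately have "(r + 2)\<^sup>2 * (D * r\<^sup>2) + D * r * ((2 * r + 3 + (r + 1) * u) + (2 * r + 3 + (r + 1) * u))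
     + D * t + r\<^sup>2 * (r + 2) \<le> T"
    using assms(7) by linarith
  moreover have "D * r + D = D * t + D * u"
    using arg_cong[OF u, of "\<lambda>x. D * x"] by (simp add: algebra_simps)
  ultimately show ?thesis using c du
    by (simp add: algebra_simps power2_eq_square)
qed

text \<open>Write the factors as \<open>r + e1\<close>, \<open>r + e2\<close>,
  \<open>even_path_poly r k + e3\<close> and expand. The terms linear in the excesses, together with
  \<open>e1 * e2 \<ge> 1\<close> on the diagonal, suffice unless \<open>r = k = 1\<close>. There
  \<open>even_path_poly r k = 1\<close> is too small for \<open>theta_ineq\<close>, but all three
  paths have length two, so \<open>e3\<close> obeys the stronger bound known for \<open>e1\<close>
  and \<open>e2\<close>.\<close>

lemma theta_count_distinct_ends:
  assumes q: "q_lists (r + 2) (A # B # L # M # Vs)" and len: "length Vs + 1 = 2 * k"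
    and r: "r \<ge> 1" and AB: "A \<noteq> B"
  shows "theta_poly r k \<le> theta_count A B L M (path_count Vs)"
proof -
  let ?D = "even_path_poly r k" and ?t = "card (A \<inter> B)"
  define e1 where "e1 a b = card (L - {a, b}) - r" for a b
  define e2 where "e2 a b = card (M - {a, b}) - r" for a b
  define e3 where "e3 a b = path_count Vs a b - ?D" for a b
  define S where "S e = (\<Sum>a\<in>A. \<Sum>b\<in>B. e a b)" for e :: "nat \<Rightarrow> nat \<Rightarrow> nat"
  have fin: "finite A" "finite B" "finite L" "finite M"
    and card: "card A = r + 2" "card B = r + 2" "card L = r + 2" "card M = r + 2"
    using q by auto
  have l: "card (L - {a, b}) = r + e1 a b" and m: "card (M - {a, b}) = r + e2 a b"
    and n: "path_count Vs a b = ?D + e3 a b" for a b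
    using card_Diff_doubleton_ge(1)[of L r a b] card_Diff_doubleton_ge(1)[of M r a b]
      path_count_ge[of r Vs k a b] q len
    by (auto simp: e1_def e2_def e3_def)
  have diag: "1 \<le> e1 a a" "1 \<le> e2 a a" for a
    using card_Diff_doubleton_ge(2)[of L r a] card_Diff_doubleton_ge(2)[of M r a] fin card
      l[of a a] m[of a a] by auto
  \<comment> \<open>This is where \<open>A \<noteq> B\<close> enters: for equal lists the
    intersection would have size \<open>r + 2\<close>.\<close>
  have t: "?t \<le> r + 1"
  proof -
    have "A \<inter> B \<subset> A" using AB fin card card_subset_eq by (metis inf.cobounded1 inf.absorb_iff1 psubsetI)
    then have "?t < card A" using fin by (intro psubset_card_mono)
    then show ?thesis using card by simp
  qed
  have S12: "(r + 2)\<^sup>2 \<le> S (\<lambda>a b. card (X - {a, b}) - r) + (r + 1) * ?t"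
    if "finite X" "card X = r + 2" for X
  proof -
    have "(\<Sum>a\<in>A. \<Sum>b\<in>B. card (X - {a, b})) = S (\<lambda>a b. card (X - {a, b}) - r) + (r + 2) * (r + 2) * r"
      using sum_excess[of r "\<lambda>a b. card (X - {a, b})" B A, OF card_Diff_doubleton_ge(1)[OF that]] unfolding S_def card .
    moreover have "(r + 2)\<^sup>2 * (r + 1) = (r + 2)\<^sup>2 + (r + 2) * (r + 2) * r"
      by (simp add: power2_eq_square)
    ultimately show ?thesis
      using sum_card_Diff_ge[OF fin(1,2) that(1) card(1,2) that(2)] by linarith
  qed
  have S1: "(r + 2)\<^sup>2 \<le> S e1 + (r + 1) * ?t" and S2: "(r + 2)\<^sup>2 \<le> S e2 + (r + 1) * ?t"
    using S12[of L] S12[of M] fin card by (simp_all add: e1_def[abs_def] e2_def[abs_def])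
  \<comment> \<open>For each of the \<open>r + 2\<close> colours \<open>b\<close>, the sum over all
    \<open>a\<close> is at least \<open>(r + 1) ^ (2 * k) = (r + 2) * ?D + 1\<close>, an excess of
    at least one.\<close>
  have S3: "r + 2 \<le> S e3"
  proof -
    have "(\<Sum>b\<in>B. (r + 1) ^ (2 * k)) \<le> (\<Sum>b\<in>B. \<Sum>a\<in>A. path_count Vs a b)"
      using sum_path_count_ge[of "r + 1" A Vs] q len[symmetric] by (intro sum_mono) auto
    then have "(r + 2) * ((r + 2) * ?D + 1) \<le> (\<Sum>a\<in>A. \<Sum>b\<in>B. path_count Vs a b)"
      using card by (subst sum.swap) (simp only: even_path_poly_eq sum_constant, simp)
    moreover have "(\<Sum>a\<in>A. \<Sum>b\<in>B. path_count Vs a b) = S e3 + (r + 2) * (r + 2) * ?D"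
      using sum_excess[of ?D "path_count Vs" B A, OF path_count_ge[OF _ len]] q
      unfolding S_def e3_def card by simp
    moreover have "(r + 2) * ((r + 2) * ?D + 1) = (r + 2) + (r + 2) * (r + 2) * ?D"
      by (simp add: algebra_simps)
    ultimately show ?thesis by linarith
  qed
  show ?thesis
  proof (cases "r = 1 \<and> k = 1")
    case True
    then have "length Vs = 1" using len by simp
    then obtain V where V0: "Vs = [V]" by (auto simp: length_Suc_conv)
    then have V: "Vs = [V]" "finite V" "card V = r + 2" using q by simp_all
    have N: "path_count Vs = (\<lambda>a b. card (V - {a, b}))"
      using V by (simp add: fun_eq_iff path_count_single del: path_count.simps)
    have D: "?D = r" using True by simp
    have S3': "(r + 2)\<^sup>2 \<le> S e3 + (r + 1) * ?t"
      using S12[OF V(2,3)] by (simp add: e3_def[abs_def] N D)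
    have diag3: "1 \<le> e3 a a" for a
      using card_Diff_doubleton_ge(2)[OF V(2,3), of a] D by (simp add: e3_def N)
    \<comment> \<open>The product is \<open>(1 + e1) * (1 + e2) * (1 + e3)\<close>; on the diagonal
      all excesses are positive, so the four mixed terms contribute at least 4.\<close>
    have "1 + e1 a b + e2 a b + e3 a b + 4 * of_bool (a = b)
        \<le> card (L - {a, b}) * card (M - {a, b}) * path_count Vs a b" for a b
    proof (cases "a = b")
      case ab: True
      obtain x y z where "e1 a a = 1 + x" "e2 a a = 1 + y" "e3 a a = 1 + z"
        using diag[of a] diag3[of a] le_Suc_ex by metis
      then show ?thesis unfolding l m n D using ab True by (simp add: algebra_simps)
    next
      case False
      then show ?thesis unfolding l m n D using True by (simp add: algebra_simps)
    qed
    then have "(\<Sum>a\<in>A. \<Sum>b\<in>B. 1 + e1 a b + e2 a b + e3 a b + 4 * of_bool (a = b))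
        \<le> theta_count A B L M (path_count Vs)"
      unfolding theta_count_def by (intro sum_mono)
    moreover have "(\<Sum>a\<in>A. \<Sum>b\<in>B. 1 + e1 a b + e2 a b + e3 a b + 4 * of_bool (a = b))
        = (r + 2) * (r + 2) + S e1 + S e2 + S e3 + 4 * ?t"
      using fin card
      by (simp only: sum.distrib S_def sum_distrib_left[symmetric] sum_of_bool_diagonal) simp
    ultimately show ?thesis
      using S1 S2 S3' t True by (simp add: theta_poly_def power2_eq_square)
  next
    case False
    have "?D * r\<^sup>2 + ?D * r * (e1 a b + e2 a b) + ?D * of_bool (a = b) + r\<^sup>2 * e3 a b
        \<le> card (L - {a, b}) * card (M - {a, b}) * path_count Vs a b" for a b
    proof -
      have "of_bool (a = b) \<le> e1 a b * e2 a b" using diag[of a] by auto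
      then have "?D * of_bool (a = b) \<le> ?D * (e1 a b * e2 a b)" by (rule mult_le_mono2)
      moreover have "?D * r\<^sup>2 + ?D * r * (e1 a b + e2 a b) + ?D * (e1 a b * e2 a b) + r\<^sup>2 * e3 a b
          \<le> card (L - {a, b}) * card (M - {a, b}) * path_count Vs a b"
        unfolding l m n by (simp add: algebra_simps power2_eq_square)
      ultimately show ?thesis by linarith
    qed
    then have "(\<Sum>a\<in>A. \<Sum>b\<in>B. ?D * r\<^sup>2 + ?D * r * (e1 a b + e2 a b) + ?D * of_bool (a = b) + r\<^sup>2 * e3 a b)
        \<le> theta_count A B L M (path_count Vs)"
      unfolding theta_count_def by (intro sum_mono)
    moreover have "(\<Sum>a\<in>A. \<Sum>b\<in>B. ?D * r\<^sup>2 + ?D * r * (e1 a b + e2 a b) + ?D * of_bool (a = b) + r\<^sup>2 * e3 a b)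
        = (r + 2)\<^sup>2 * (?D * r\<^sup>2) + ?D * r * (S e1 + S e2) + ?D * ?t + r\<^sup>2 * S e3"
      using fin card
      by (simp only: sum.distrib S_def sum_distrib_left[symmetric] sum_of_bool_diagonal)
        (simp add: algebra_simps power2_eq_square)
    moreover have "?D \<ge> 3 \<or> (r \<ge> 2 \<and> ?D \<ge> 2)"
    proof -
      obtain j where j: "k = Suc j" using len by (cases k) auto
      show ?thesis
      proof (cases "r = 1")
        case True
        \<comment> \<open>Here \<open>k = i + 2\<close>, and the two leading summands
          \<open>4 * 4 ^ i\<close> and \<open>4 ^ i\<close> of the polynomial combine to
          \<open>5 * 4 ^ i\<close>.\<close>
        then obtain i where "j = Suc i" using False j by (cases j) auto
        then have "?D = 5 * 2 ^ (2 * i) + even_path_poly 1 i"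
          using True j by (simp flip: numeral_2_eq_2)
        moreover have "1 \<le> (2::nat) ^ (2 * i)" by simp
        ultimately show ?thesis by linarith
      next
        case False
        moreover have "r * 1 \<le> r * (r + 1) ^ (2 * j)" by (intro mult_le_mono2) simp
        ultimately have "2 \<le> ?D" "2 \<le> r" unfolding j even_path_poly.simps using r by linarith+
        then show ?thesis by simp
      qed
    qed
    ultimately show ?thesis
      unfolding theta_poly_def using theta_ineq[OF r t S1 S2 S3] by simp
  qed
qed

lemma theta_count_ge:
  assumes "q_lists (r + 2) (A # B # L # M # Vs)" "length Vs + 1 = 2 * k" "r \<ge> 1"
  shows "theta_poly r k \<le> theta_count A B L M (path_count Vs)"
  using theta_count_same_ends[of r A L M Vs k] theta_count_distinct_ends[of r A B L M Vs k] assms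
  by (cases "A = B") auto


subsection \<open>Theta graphs with lists of size two\<close>

text \<open>Colouring greedily from \<open>a\<close>, every list of size two keeps a colour, and the
  last colour used cannot equal both \<open>b\<close> and \<open>b'\<close>.\<close>

lemma path_count_row:
  assumes "q_lists 2 Vs" "b \<noteq> b'"
  shows "1 \<le> path_count Vs a b + path_count Vs a b'"
  using assms(1)
proof (induction Vs arbitrary: a)
  case (Cons V Vs)
  have "card (V - {a}) \<ge> 1" using Cons.prems by (auto simp: card_Diff_singleton_if)
  then have "V - {a} \<noteq> {}" by (metis card.empty not_one_le_zero)
  then obtain c where c: "c \<in> V - {a}" by blast
  then have "path_count Vs c b \<le> path_count (V # Vs) a b" "path_count Vs c b' \<le> path_count (V # Vs) a b'"
    unfolding path_count.simps using Cons.prems by (auto intro!: member_le_sum)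
  moreover have "1 \<le> path_count Vs c b + path_count Vs c b'" using Cons by simp
  ultimately show ?case by linarith
qed (use assms(2) in auto)

text \<open>With a free start some first colour extends to a colouring ending at \<open>b\<close>,
  and this colour differs from \<open>a\<close> or from \<open>a'\<close>.\<close>

lemma path_count_column:
  assumes "q_lists 2 Vs" "a \<noteq> a'"
  shows "1 \<le> path_count Vs a b + path_count Vs a' b"
proof (cases Vs)
  case Nil
  then show ?thesis using assms by auto
next
  case (Cons V Ws)
  have "1 \<le> (\<Sum>c\<in>V. path_count Ws c b)"
    using sum_path_count_ge[of 1 V Ws b] assms Cons by (simp add: numeral_2_eq_2)
  also have "\<dots> \<le> (\<Sum>c\<in>(V - {a}) \<union> (V - {a'}). path_count Ws c b)"
    using assms Cons by (intro sum_mono2) auto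
  also have "\<dots> \<le> (\<Sum>c\<in>V - {a}. path_count Ws c b) + (\<Sum>c\<in>V - {a'}. path_count Ws c b)"
    using assms Cons by (simp add: sum_Un_nat)
  finally show ?thesis using Cons by simp
qed

text \<open>A pair of end colours is blocked by a path with lists of size two only through a chain of
  forced colours; a colouring for the opposite pair follows the chain backwards up to some point
  and forwards from there, so there are at least as many as the chain has places where it fails
  to alternate between two colours.\<close>

lemma path_count_opposite:
  assumes "q_lists 2 Vs" "path_count Vs a e = 0" "a \<noteq> a'" "e \<noteq> e'"
  shows "(if even (length Vs) then of_bool (a' \<noteq> e') + of_bool (a \<noteq> e)
      else of_bool (a' \<noteq> e) + of_bool (a \<noteq> e')) \<le> path_count Vs a' e'"
  using assms(1-3)
proof (induction Vs arbitrary: a a')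
  case Nil
  then show ?case using assms(4) by (auto split: if_splits)
next
  case (Cons V Vs)
  have V: "finite V" "card V = 2" and Vs: "q_lists 2 Vs" using Cons.prems by auto
  have zero: "path_count Vs c e = 0" if "c \<in> V" "c \<noteq> a" for c
    using Cons.prems(2) V that by auto
  \<comment> \<open>Otherwise both colours of \<open>V\<close> would be available after
    \<open>a\<close> and both would be blocked towards \<open>e\<close>, against the column
    bound.\<close>
  have "a \<in> V"
  proof (rule ccontr)
    assume "a \<notin> V"
    obtain c d where "V = {c, d}" "c \<noteq> d" using V by (auto simp: card_2_iff)
    then show False
      using zero[of c] zero[of d] path_count_column[OF Vs, of c d e] \<open>a \<notin> V\<close> by auto
  qed
  then obtain u where u: "V = {a, u}" "u \<noteq> a" using V by (auto simp: card_2_iff)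
  then have u0: "path_count Vs u e = 0" using zero by simp
  have IH: "(if even (length Vs) then of_bool (a \<noteq> e') + of_bool (u \<noteq> e)
      else of_bool (a \<noteq> e) + of_bool (u \<noteq> e')) \<le> path_count Vs a e'"
    using Cons.IH[OF Vs u0 u(2)] .
  \<comment> \<open>Trades the term for \<open>u\<close> in the induction hypothesis for the one for
    \<open>a'\<close>: either \<open>u = a'\<close>, or \<open>u\<close> is available as well and
    adds a colouring. The parity of the length decides whether \<open>x\<close> is \<open>e\<close>
    or \<open>e'\<close>.\<close>
  have "of_bool (a' \<noteq> x) + path_count Vs a e' \<le> path_count (V # Vs) a' e' + of_bool (u \<noteq> x)" for x
  proof (cases "u = a'")
    case True
    then have "V - {a'} = {a}" using u by auto
    then show ?thesis using True by simp
  next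
    case False
    then have "V - {a'} = {a, u}" using u Cons.prems(3) by auto
    then have "path_count (V # Vs) a' e' = path_count Vs a e' + path_count Vs u e'"
      using u by simp
    moreover have "1 \<le> path_count Vs u e'" using path_count_row[OF Vs assms(4), of u] u0 by simp
    moreover have "of_bool (a' \<noteq> x) \<le> (1 :: nat)" by simp
    ultimately show ?thesis by linarith
  qed
  from this[of e] this[of e'] show ?case
    using IH unfolding length_Cons even_Suc by presburger
qed

text \<open>The inner vertices, odd in number, alternate between the other colour of their list and
  \<open>y\<close>, starting and ending with the former.\<close>

lemma path_count_common_colour:
  assumes "q_lists 2 Vs" "length Vs + 1 = 2 * k" "\<forall>V\<in>set Vs. y \<in> V"
  shows "1 \<le> path_count Vs y y"
  using assms
proof (induction k arbitrary: Vs)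
  case (Suc k)
  show ?case
  proof (cases "k = 0")
    case True
    then have "length Vs = 1" using Suc.prems(2) by simp
    then obtain V where "Vs = [V]" by (auto simp: length_Suc_conv)
    then show ?thesis using card_Diff_doubleton_ge(2)[of V 0 y] Suc.prems
      by (simp add: path_count_single del: path_count.simps)
  next
    case False
    then obtain U V Ws where Vs: "Vs = U # V # Ws" and len: "length Ws + 1 = 2 * k"
      using Suc.prems by (cases Vs; cases "tl Vs") auto
    have "card (U - {y}) = 1" using Suc.prems Vs by simp
    then obtain u where u: "u \<in> U - {y}" by (metis card_1_singletonE insertI1)
    have "path_count Ws y y \<le> path_count (V # Ws) u y"
      unfolding path_count.simps using Suc.prems Vs u by (intro member_le_sum) auto
    also have "\<dots> \<le> path_count (U # V # Ws) y y"
      unfolding path_count.simps(2)[of U] using Suc.prems Vs u by (intro member_le_sum) auto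
    finally show ?thesis using Suc.IH[OF _ len] Suc.prems Vs by simp
  qed
qed simp

text \<open>What the case analysis of end pairs needs to know about the long path. The conditions
  are symmetric in the two ends, so exchanging the ends requires no reversal of the path.\<close>

definition blocking :: "(nat \<Rightarrow> nat \<Rightarrow> nat) \<Rightarrow> bool" where
  "blocking N \<longleftrightarrow>
    (\<forall>a b b'. b \<noteq> b' \<longrightarrow> 1 \<le> N a b + N a b') \<and>
    (\<forall>a a' b. a \<noteq> a' \<longrightarrow> 1 \<le> N a b + N a' b) \<and>
    (\<forall>a a' b b'. a \<noteq> a' \<longrightarrow> b \<noteq> b' \<longrightarrow> N a b = 0 \<longrightarrow>
      of_bool (a' \<noteq> b) + of_bool (a \<noteq> b') \<le> N a' b')"

lemma blockingD:
  assumes "blocking N"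
  shows "b \<noteq> b' \<Longrightarrow> 1 \<le> N a b + N a b'"
    and "a \<noteq> a' \<Longrightarrow> 1 \<le> N a b + N a' b"
    and "a \<noteq> a' \<Longrightarrow> b \<noteq> b' \<Longrightarrow> N a b = 0 \<Longrightarrow> of_bool (a' \<noteq> b) + of_bool (a \<noteq> b') \<le> N a' b'"
  using assms unfolding blocking_def by (simp_all del: One_nat_def)

lemma blocking_path_count:
  assumes "q_lists 2 Vs" "length Vs + 1 = 2 * k"
  shows "blocking (path_count Vs)"
proof -
  have "odd (length Vs)" using assms(2) by presburger
  then have "of_bool (a' \<noteq> b) + of_bool (a \<noteq> b') \<le> path_count Vs a' b'"
    if "path_count Vs a b = 0" "a \<noteq> a'" "b \<noteq> b'" for a a' b b'
    using path_count_opposite[OF assms(1) that] by simp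
  then show ?thesis
    unfolding blocking_def
    using path_count_row[OF assms(1)] path_count_column[OF assms(1)] by blast
qed

section \<open>Which pairs of end colours are blocked by the middle lists\<close>

lemma theta_count_ge_pair:
  assumes "finite A" "finite B" "a \<in> A" "b \<in> B" "a' \<in> A" "b' \<in> B" "(a, b) \<noteq> (a', b')"
  shows "card (L - {a, b}) * card (M - {a, b}) * N a b + card (L - {a', b'}) * card (M - {a', b'}) * N a' b'
    \<le> theta_count A B L M N"
proof -
  let ?f = "\<lambda>(a, b). card (L - {a, b}) * card (M - {a, b}) * N a b"
  have "theta_count A B L M N = (\<Sum>p\<in>A \<times> B. ?f p)"
    unfolding theta_count_def by (rule sum.cartesian_product)
  also have "(\<Sum>p\<in>{(a, b), (a', b')}. ?f p) \<le> \<dots>"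
    using assms by (intro sum_mono2) auto
  also have "(\<Sum>p\<in>{(a, b), (a', b')}. ?f p) = ?f (a, b) + ?f (a', b')"
    using assms(7) by simp
  finally show ?thesis by simp
qed

lemma theta_count_swap_middle: "theta_count A B L M N = theta_count A B M L N"
  by (simp add: theta_count_def mult.commute mult.left_commute)

lemma theta_count_swap_ends: "theta_count A B L M N = theta_count B A L M (\<lambda>a b. N b a)"
  unfolding theta_count_def by (subst sum.swap) (simp add: insert_commute)

lemma blocking_swap: "blocking N \<Longrightarrow> blocking (\<lambda>a b. N b a)"
  unfolding blocking_def[of "\<lambda>a b. N b a"]
proof (intro conjI allI impI)
  fix a a' b b'
  assume N: "blocking N" and "a \<noteq> a'" "b \<noteq> b'" "N b a = 0"
  then have "of_bool (b' \<noteq> a) + of_bool (b \<noteq> a') \<le> N b' a'" by (intro blockingD(3))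
  then show "of_bool (a' \<noteq> b) + of_bool (a \<noteq> b') \<le> N b' a'" by (simp add: eq_commute)
qed (use blockingD in auto)

text \<open>The only shape of two-element lists for which at most one colouring can exist.\<close>

definition tight :: "nat set \<Rightarrow> nat set \<Rightarrow> nat set \<Rightarrow> nat set \<Rightarrow> (nat \<Rightarrow> nat \<Rightarrow> nat) \<Rightarrow> bool" where
  "tight A B L M N \<longleftrightarrow> (\<exists>x y z. x \<noteq> y \<and> y \<noteq> z \<and> x \<noteq> z \<and> {A, B} = {{x, y}, {y, z}} \<and>
     {L, M} = {{x, y}, {x, z}} \<and> N y y = 0)"

lemma tight_swap: "tight B A L M (\<lambda>a b. N b a) \<Longrightarrow> tight A B L M N"
  "tight A B M L N \<Longrightarrow> tight A B L M N"
  unfolding tight_def by (simp_all add: insert_commute)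

lemma theta_count_ge_unblocked:
  assumes "finite A" "finite B" "finite L" "finite M" "a \<in> A" "b \<in> B" "a' \<in> A" "b' \<in> B"
    and "(a, b) \<noteq> (a', b')"
    and "\<not> L \<subseteq> {a, b}" "\<not> M \<subseteq> {a, b}" "\<not> L \<subseteq> {a', b'}" "\<not> M \<subseteq> {a', b'}"
  shows "N a b + N a' b' \<le> theta_count A B L M N"
proof -
  have pos: "1 \<le> card (X - {x, y})" if "finite X" "\<not> X \<subseteq> {x, y}" for X :: "nat set" and x y
    using that by (simp add: Suc_le_eq card_gt_0_iff)
  have ge: "1 * 1 * N x y \<le> card (L - {x, y}) * card (M - {x, y}) * N x y"
    if "\<not> L \<subseteq> {x, y}" "\<not> M \<subseteq> {x, y}" for x y
    using pos that assms(3,4) by (intro mult_le_mono) auto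
  show ?thesis
    using theta_count_ge_pair[OF assms(1,2,5-9), of L M N] ge[OF assms(10,11)] ge[OF assms(12,13)]
    by linarith
qed

text \<open>The middle lists block both pairs starting with \<open>a\<close>, and the long path
  blocks at most one of \<open>(a', b)\<close> and \<open>(a', b')\<close>. If it blocks
  \<open>(a', b)\<close>, the list \<open>{a, b}\<close> keeps both colours against
  \<open>(a', b')\<close> and doubles that pair, unless \<open>b = a'\<close>, which is the tight
  shape with \<open>y = a'\<close>. Blocking of \<open>(a', b')\<close> is analogous.\<close>

lemma theta_count_row_blocked:
  assumes "blocking N" "a \<noteq> a'" "b \<noteq> b'" "a \<noteq> b" "a \<noteq> b'"
  defines "T \<equiv> theta_count {a, a'} {b, b'} {a, b} {a, b'} N"
  shows "1 \<le> T \<and> (2 \<le> T \<or> tight {a, a'} {b, b'} {a, b} {a, b'} N)"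
proof -
  have T: "N a' b + N a' b' \<le> T"
    unfolding T_def using assms by (intro theta_count_ge_unblocked) auto
  moreover have 1: "1 \<le> N a' b + N a' b'" using blockingD(1)[OF assms(1,3)] .
  moreover have "2 \<le> T \<or> tight {a, a'} {b, b'} {a, b} {a, b'} N" if zero: "N a' b = 0"
  proof (cases "b = a'")
    case True
    then have "tight {a, a'} {b, b'} {a, b} {a, b'} N"
      unfolding tight_def using assms zero by (intro exI[of _ a] exI[of _ a'] exI[of _ b']) auto
    then show ?thesis ..
  next
    case False
    have "{a, b} - {a', b'} = {a, b}" "{a, b'} - {a', b'} = {a}" using assms False by auto
    then have "2 * N a' b' \<le> T"
      using theta_count_ge_pair[of "{a, a'}" "{b, b'}" a' b a' b' "{a, b}" "{a, b'}" N] assms by auto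
    then show ?thesis using 1 zero by simp
  qed
  moreover have "2 \<le> T \<or> tight {a, a'} {b, b'} {a, b} {a, b'} N" if zero: "N a' b' = 0"
  proof (cases "b' = a'")
    case True
    then have "tight {a, a'} {b, b'} {a, b} {a, b'} N"
      unfolding tight_def using assms zero by (intro exI[of _ a] exI[of _ a'] exI[of _ b]) auto
    then show ?thesis ..
  next
    case False
    have "{a, b'} - {a', b} = {a, b'}" "{a, b} - {a', b} = {a}" using assms False by auto
    then have "2 * N a' b \<le> T"
      using theta_count_ge_pair[of "{a, a'}" "{b, b'}" a' b a' b' "{a, b}" "{a, b'}" N] assms by auto
    then show ?thesis using 1 zero by simp
  qed
  ultimately show ?thesis by linarith
qed

text \<open>The pairs \<open>(a, b')\<close> and \<open>(a', b)\<close> survive the middle lists. If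
  the long path blocks one of them, the other has two colourings because \<open>a \<noteq> b\<close>
  and \<open>a' \<noteq> b'\<close>.\<close>

lemma theta_count_opposite_blocked:
  assumes "blocking N" "a \<noteq> a'" "b \<noteq> b'" "a \<noteq> b" "a' \<noteq> b'"
  shows "2 \<le> theta_count {a, a'} {b, b'} {a, b} {a', b'} N"
proof -
  have "N a b' + N a' b \<le> theta_count {a, a'} {b, b'} {a, b} {a', b'} N"
    using assms by (intro theta_count_ge_unblocked) auto
  moreover have "N a b' = 0 \<longrightarrow> 2 \<le> N a' b" "N a' b = 0 \<longrightarrow> 2 \<le> N a b'"
  proof -
    have "N a b' = 0 \<longrightarrow> of_bool (a' \<noteq> b') + of_bool (a \<noteq> b) \<le> N a' b"
      "N a' b = 0 \<longrightarrow> of_bool (a \<noteq> b) + of_bool (a' \<noteq> b') \<le> N a b'"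
      using blockingD(3)[OF assms(1,2), of b' b] blockingD(3)[OF assms(1) assms(2)[symmetric] assms(3)]
        assms(3) by simp_all
    then show "N a b' = 0 \<longrightarrow> 2 \<le> N a' b" "N a' b = 0 \<longrightarrow> 2 \<le> N a b'"
      using assms(4,5) by auto
  qed
  ultimately show ?thesis by linarith
qed

text \<open>The long path blocks at most one of the three remaining pairs: pairs sharing an end
  colour by the row and column bounds, and \<open>(a, b')\<close>, \<open>(a', b)\<close> because
  both indicators for opposite pairs vanish only if the end lists agree.\<close>

lemma theta_count_three_unblocked:
  assumes "blocking N" "a \<noteq> a'" "b \<noteq> b'" "{a, a'} \<noteq> {b, b'}" "finite L" "finite M"
    and "\<And>X. X \<in> {L, M} \<Longrightarrow> \<not> X \<subseteq> {a, b'} \<and> \<not> X \<subseteq> {a', b} \<and> \<not> X \<subseteq> {a', b'}"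
  shows "2 \<le> theta_count {a, a'} {b, b'} L M N"
proof -
  let ?T = "theta_count {a, a'} {b, b'} L M N"
  have "N a b' + N a' b \<le> ?T" "N a b' + N a' b' \<le> ?T" "N a' b + N a' b' \<le> ?T"
    by (rule theta_count_ge_unblocked; use assms(2,3,5-7) in auto)+
  moreover have "1 \<le> N a b' + N a' b'" "1 \<le> N a' b + N a' b'"
    using blockingD(2)[OF assms(1,2)] blockingD(1)[OF assms(1,3)] by blast+
  moreover have "N a b' = 0 \<longrightarrow> 1 \<le> N a' b"
  proof -
    have "N a b' = 0 \<longrightarrow> of_bool (a' \<noteq> b') + of_bool (a \<noteq> b) \<le> N a' b"
      using blockingD(3)[OF assms(1,2), of b' b] assms(3) by simp
    then show ?thesis using assms(4) by (cases "a' = b'"; cases "a = b") auto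
  qed
  ultimately show ?thesis by linarith
qed

text \<open>If \<open>A = B\<close>, no middle list blocks the two diagonal pairs, and if the path
  blocks one of them, the other has two colourings. If \<open>A \<noteq> B\<close>, a middle list of
  size two blocks at most one end pair, and the cases are the relative positions of these blocked
  pairs.\<close>

lemma theta_count_two_lists:
  assumes "blocking N" "finite A" "card A = 2" "finite B" "card B = 2"
    "finite L" "card L = 2" "finite M" "card M = 2"
  shows "1 \<le> theta_count A B L M N \<and> (2 \<le> theta_count A B L M N \<or> tight A B L M N)"
proof (cases "A = B")
  case True
  obtain a a' where A: "A = {a, a'}" "a \<noteq> a'" using assms by (auto simp: card_2_iff)
  have nsub: "\<not> X \<subseteq> {x, x}" if "card X = 2" for X and x :: nat
    using that card_mono[of "{x, x}" X] by auto
  have "N a a + N a' a' \<le> theta_count A B L M N"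
    using True A assms nsub by (intro theta_count_ge_unblocked) auto
  moreover have "N a a = 0 \<longrightarrow> of_bool (a' \<noteq> a) + of_bool (a \<noteq> a') \<le> N a' a'"
     "N a' a' = 0 \<longrightarrow> of_bool (a \<noteq> a') + of_bool (a' \<noteq> a) \<le> N a a"
    using blockingD(3)[OF assms(1) A(2) A(2)] blockingD(3)[OF assms(1) A(2)[symmetric] A(2)[symmetric]]
    by simp_all
  ultimately have "2 \<le> theta_count A B L M N" using A by auto
  then show ?thesis by simp
next
  case ne: False
  have eq: "X = {x, y} \<and> x \<noteq> y" if "X \<subseteq> {x, y}" "card X = 2" for X and x y :: nat
  proof -
    have "card {x, y} \<le> 2" by (simp add: card_insert_if)
    then have "X = {x, y}" using that card_subset_eq[of "{x, y}" X] card_mono[of "{x, y}" X] by auto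
    then show ?thesis using that by (auto simp: card_insert_if split: if_splits)
  qed
  have main: "1 \<le> theta_count A B X Y N \<and> (2 \<le> theta_count A B X Y N \<or> tight A B X Y N)"
    if blk: "a \<in> A" "b \<in> B" "X \<subseteq> {a, b}" and X: "finite X" "card X = 2"
      and Y: "finite Y" "card Y = 2" for a b X Y
  proof -
    have Xe: "X = {a, b}" "a \<noteq> b" using eq blk X by auto
    obtain a' where A: "A = {a, a'}" "a \<noteq> a'" using assms blk by (auto simp: card_2_iff)
    obtain b' where B: "B = {b, b'}" "b \<noteq> b'" using assms blk by (auto simp: card_2_iff)
    consider (opp) "Y \<subseteq> {a', b'}" | (row) "Y \<subseteq> {a, b'}" | (col) "Y \<subseteq> {a', b}"
      | (none) "\<not> Y \<subseteq> {a, b'} \<and> \<not> Y \<subseteq> {a', b} \<and> \<not> Y \<subseteq> {a', b'}" by blast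
    then show ?thesis
    proof cases
      case opp
      then show ?thesis
        using theta_count_opposite_blocked[OF assms(1) A(2) B(2) Xe(2)] eq[OF opp Y(2)] A B Xe by simp
    next
      case row
      then show ?thesis
        using theta_count_row_blocked[OF assms(1) A(2) B(2) Xe(2)] eq[OF row Y(2)] A B Xe by simp
    next
      case col
      then have Ye: "Y = {b, a'}" "b \<noteq> a'" using eq[OF col Y(2)] by auto
      \<comment> \<open>A blocked column becomes a blocked row after exchanging the ends.\<close>
      have "X = {b, a}" using Xe by auto
      then have "1 \<le> theta_count B A X Y (\<lambda>a b. N b a)
          \<and> (2 \<le> theta_count B A X Y (\<lambda>a b. N b a) \<or> tight B A X Y (\<lambda>a b. N b a))"
        using theta_count_row_blocked[OF blocking_swap[OF assms(1)] B(2) A(2) Xe(2)[symmetric] Ye(2)]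
        unfolding A(1) B(1) Ye(1) by blast
      then show ?thesis
        using tight_swap(1)[of B A X Y N] theta_count_swap_ends[of A B X Y N] by auto
    next
      case none
      have "2 \<le> theta_count {a, a'} {b, b'} X Y N"
      proof (rule theta_count_three_unblocked[OF assms(1) A(2) B(2) _ X(1) Y(1)])
        show AB: "{a, a'} \<noteq> {b, b'}" using ne A B by simp
        have "\<not> X \<subseteq> {a, b'}" "\<not> X \<subseteq> {a', b}" unfolding Xe(1) using Xe(2) A(2) B(2) by auto
        moreover have "\<not> X \<subseteq> {a', b'}" unfolding Xe(1) using Xe(2) A(2) B(2) AB by auto
        ultimately show "\<not> Z \<subseteq> {a, b'} \<and> \<not> Z \<subseteq> {a', b} \<and> \<not> Z \<subseteq> {a', b'}" if "Z \<in> {X, Y}" for Z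
          using that none by blast
      qed
      then show ?thesis using A B by simp
    qed
  qed
  consider (L) a b where "a \<in> A" "b \<in> B" "L \<subseteq> {a, b}" | (M) a b where "a \<in> A" "b \<in> B" "M \<subseteq> {a, b}"
    | (none) "\<forall>a\<in>A. \<forall>b\<in>B. \<not> L \<subseteq> {a, b} \<and> \<not> M \<subseteq> {a, b}" by blast
  then show ?thesis
  proof cases
    case L
    then show ?thesis using main assms by blast
  next
    case M
    then show ?thesis
      using main[OF M, of L] assms tight_swap(2)[of A B M L N] theta_count_swap_middle[of A B L M N]
      by auto
  next
    case none
    obtain a a' where A: "A = {a, a'}" "a \<noteq> a'" using assms by (auto simp: card_2_iff)
    obtain b b' where B: "B = {b, b'}" "b \<noteq> b'" using assms by (auto simp: card_2_iff)
    have "2 \<le> theta_count {a, a'} {b, b'} L M N"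
    proof (rule theta_count_three_unblocked[OF assms(1) A(2) B(2) _ assms(6,8)])
      show "{a, a'} \<noteq> {b, b'}" using ne A B by simp
      show "\<not> Z \<subseteq> {a, b'} \<and> \<not> Z \<subseteq> {a', b} \<and> \<not> Z \<subseteq> {a', b'}" if "Z \<in> {L, M}" for Z
        using that none A B by blast
    qed
    then show ?thesis using A B by simp
  qed
qed


subsection \<open>Counting list colourings\<close>

lemma finite_proper_L_colorings:
  assumes "finite V" "\<forall>v\<in>V. finite (L v)"
  shows "finite (proper_L_colorings V E L)"
proof (rule finite_subset)
  show "proper_L_colorings V E L
      \<subseteq> {f. \<forall>x. (x \<in> V \<longrightarrow> f x \<in> (\<Union>v\<in>V. L v)) \<and> (x \<notin> V \<longrightarrow> f x = undefined)}"
    by (auto simp: proper_L_colorings_def)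
  show "finite {f. \<forall>x. (x \<in> V \<longrightarrow> f x \<in> (\<Union>v\<in>V. L v)) \<and> (x \<notin> V \<longrightarrow> f x = undefined)}"
    using assms by (intro finite_set_of_finite_funs) auto
qed

lemma num_L_colorings_cong:
  assumes "\<And>v. v \<in> V \<Longrightarrow> L v = L' v"
  shows "num_L_colorings V E L = num_L_colorings V E L'"
  using assms unfolding num_L_colorings_def proper_L_colorings_def
  by (intro arg_cong[of _ _ card] Collect_cong) auto

lemma num_L_colorings_mono:
  assumes "finite V" "\<And>v. v \<in> V \<Longrightarrow> finite (L v)" "\<And>v. v \<in> V \<Longrightarrow> L' v \<subseteq> L v"
  shows "num_L_colorings V E L' \<le> num_L_colorings V E L"
  unfolding num_L_colorings_def
proof (rule card_mono)
  show "proper_L_colorings V E L' \<subseteq> proper_L_colorings V E L"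
    using assms(3) unfolding proper_L_colorings_def by blast
qed (use assms finite_proper_L_colorings in blast)

lemma num_L_colorings_empty [simp]: "num_L_colorings {} E L = 1"
proof -
  have "proper_L_colorings {} E L = {\<lambda>_. undefined}"
    by (auto simp: proper_L_colorings_def)
  then show ?thesis by (simp add: num_L_colorings_def)
qed

lemma num_L_colorings_insert:
  assumes V: "finite V" "v \<notin> V" and E: "\<And>u w. E u w \<Longrightarrow> E w u" "\<not> E v v"
    and L: "\<And>u. u \<in> insert v V \<Longrightarrow> finite (L u)"
  shows "num_L_colorings (insert v V) E L
    = (\<Sum>c\<in>L v. num_L_colorings V E (\<lambda>u. if E v u then L u - {c} else L u))"
proof -
  let ?P = "\<lambda>c. proper_L_colorings V E (\<lambda>u. if E v u then L u - {c} else L u)"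
  have "proper_L_colorings (insert v V) E L = (\<Union>c\<in>L v. (\<lambda>g. g(v := c)) ` ?P c)" (is "?A = ?B")
  proof
    show "?A \<subseteq> ?B"
    proof
      fix f assume f: "f \<in> ?A"
      then have "f(v := undefined) \<in> ?P (f v)" and "f v \<in> L v"
        using V by (auto simp: proper_L_colorings_def)
      moreover have "f = (f(v := undefined))(v := f v)" by simp
      ultimately show "f \<in> ?B" by blast
    qed
    show "?B \<subseteq> ?A"
    proof
      fix f assume "f \<in> ?B"
      then obtain c g where c: "c \<in> L v" and g: "g \<in> ?P c" and f: "f = g(v := c)" by blast
      have nbr: "g u \<in> L u \<and> (E v u \<longrightarrow> g u \<noteq> c)" if "u \<in> V" for u
        using g that by (auto simp: proper_L_colorings_def split: if_splits)
      have "f u \<noteq> f w" if "u \<in> insert v V" "w \<in> insert v V" "E u w" for u w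
        using that nbr[of u] nbr[of w] E g V f by (auto simp: proper_L_colorings_def)
      moreover have "f u \<in> L u" if "u \<in> insert v V" for u
        using that nbr[of u] c f by auto
      moreover have "f u = undefined" if "u \<notin> insert v V" for u
        using that g f by (auto simp: proper_L_colorings_def)
      ultimately show "f \<in> ?A" unfolding proper_L_colorings_def by blast
    qed
  qed
  moreover have "card (\<Union>c\<in>L v. (\<lambda>g. g(v := c)) ` ?P c) = (\<Sum>c\<in>L v. card ((\<lambda>g. g(v := c)) ` ?P c))"
  proof (rule card_UN_disjoint)
    show "\<forall>c\<in>L v. finite ((\<lambda>g. g(v := c)) ` ?P c)"
      using V L by (intro ballI finite_imageI finite_proper_L_colorings) auto
    show "\<forall>c\<in>L v. \<forall>d\<in>L v. c \<noteq> d \<longrightarrow> (\<lambda>g. g(v := c)) ` ?P c \<inter> (\<lambda>g. g(v := d)) ` ?P d = {}"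
      by (auto dest: fun_cong[of _ _ v])
  qed (use L in auto)
  moreover have "card ((\<lambda>g. g(v := c)) ` ?P c) = card (?P c)" for c
  proof (rule card_image, rule inj_onI)
    fix g h assume gh: "g \<in> ?P c" "h \<in> ?P c" "g(v := c) = h(v := c)"
    \<comment> \<open>Colourings of \<open>V\<close> have the default value at \<open>v\<close>, so
      overwriting it loses no information.\<close>
    have "g v = undefined" "h v = undefined" using gh V by (auto simp: proper_L_colorings_def)
    moreover have "g = (g(v := c))(v := g v)" "h = (h(v := c))(v := h v)" by simp_all
    ultimately show "g = h" using gh(3) by metis
  qed
  ultimately show ?thesis unfolding num_L_colorings_def by simp
qed

lemma num_L_colorings_ge_if_ge_sublists:
  assumes "finite V"
    and ge: "\<And>L. \<forall>v\<in>V. finite (L v) \<and> card (L v) = q \<Longrightarrow> p \<le> num_L_colorings V E L"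
    and L: "\<forall>v\<in>V. finite (L v) \<and> q \<le> card (L v)"
  shows "p \<le> num_L_colorings V E L"
proof -
  have "\<forall>v. \<exists>X. v \<in> V \<longrightarrow> X \<subseteq> L v \<and> card X = q \<and> finite X"
    using L by (metis obtain_subset_with_card_n)
  then obtain L' where L': "\<And>v. v \<in> V \<Longrightarrow> L' v \<subseteq> L v \<and> card (L' v) = q \<and> finite (L' v)"
    by metis
  then have "p \<le> num_L_colorings V E L'" by (intro ge) blast
  also have "\<dots> \<le> num_L_colorings V E L"
    using L L' assms(1) by (intro num_L_colorings_mono) auto
  finally show ?thesis .
qed

text \<open>Given one colouring \<open>f\<close>, removing \<open>f v\<close> from a list of size three destroys \<open>f\<close>
  but keeps all lists large, so every such vertex yields a further colouring.\<close>

lemma num_L_colorings_surplus: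
  assumes V: "finite V"
    and choosable: "\<And>L. \<forall>v\<in>V. finite (L v) \<and> card (L v) = q \<Longrightarrow> 1 \<le> num_L_colorings V E L"
    and L: "\<forall>v\<in>V. finite (L v) \<and> q \<le> card (L v)"
    and S: "S \<subseteq> V" "\<forall>v\<in>S. q < card (L v)"
  shows "card S + 1 \<le> num_L_colorings V E L"
proof -
  have pos: "1 \<le> num_L_colorings V E L" if "\<forall>v\<in>V. finite (L v) \<and> q \<le> card (L v)" for L
    using num_L_colorings_ge_if_ge_sublists[OF V choosable that] .
  have "finite S" using S(1) V finite_subset by blast
  then show ?thesis
    using L S
  proof (induction S arbitrary: L rule: finite_induct)
    case empty
    then show ?case using pos by simp
  next
    case (insert v S)
    have v: "v \<in> V" using insert.prems by simp
    have "card (proper_L_colorings V E L) \<noteq> 0"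
      using pos[OF insert.prems(1)] by (simp add: num_L_colorings_def)
    then obtain f where f: "f \<in> proper_L_colorings V E L" by fastforce
    let ?L = "L(v := L v - {f v})"
    have "f v \<in> L v" using f v by (simp add: proper_L_colorings_def)
    then have "card (?L v) = card (L v) - 1" using insert.prems(1) v by simp
    then have "card S + 1 \<le> num_L_colorings V E ?L"
      using insert.prems insert.hyps by (intro insert.IH) auto
    moreover have "insert f (proper_L_colorings V E ?L) \<subseteq> proper_L_colorings V E L"
      using f v by (auto simp: proper_L_colorings_def split: if_splits)
    moreover have "f \<notin> proper_L_colorings V E ?L"
      using v by (auto simp: proper_L_colorings_def)
    moreover have "finite (proper_L_colorings V E L)"
      using V insert.prems by (intro finite_proper_L_colorings) auto
    ultimately have "card S + 1 + 1 \<le> num_L_colorings V E L"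
      unfolding num_L_colorings_def
      using card_mono[of "proper_L_colorings V E L" "insert f (proper_L_colorings V E ?L)"]
        card_insert_disjoint[of "proper_L_colorings V E ?L" f] finite_subset
      by (metis (no_types, lifting) Suc_eq_plus1 add_le_mono1 finite_insert le_trans)
    then show ?case using insert.hyps by simp
  qed
qed

lemma num_L_colorings_Some:
  "num_L_colorings (Some ` V) (join_K1_E E) L = num_L_colorings V E (\<lambda>v. L (Some v))"
proof -
  let ?to = "\<lambda>f v. f (Some v)" and ?from = "\<lambda>g x. case x of None \<Rightarrow> undefined | Some v \<Rightarrow> g v"
  have "bij_betw ?to (proper_L_colorings (Some ` V) (join_K1_E E) L) (proper_L_colorings V E (\<lambda>v. L (Some v)))"
  proof (rule bij_betw_byWitness[where f' = ?from])
    show "\<forall>f\<in>proper_L_colorings (Some ` V) (join_K1_E E) L. ?from (?to f) = f"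
      by (auto simp: proper_L_colorings_def fun_eq_iff split: option.split)
  qed (auto simp: proper_L_colorings_def join_K1_E_def inj_image_mem_iff split: option.split)
  then show ?thesis unfolding num_L_colorings_def by (rule bij_betw_same_card)
qed

lemma num_L_colorings_join_K1:
  assumes "finite V" "\<And>u w. E u w \<Longrightarrow> E w u" "\<And>x. x \<in> join_K1_V V \<Longrightarrow> finite (L x)"
  shows "num_L_colorings (join_K1_V V) (join_K1_E E) L
    = (\<Sum>c\<in>L None. num_L_colorings V E (\<lambda>v. L (Some v) - {c}))"
proof -
  have "num_L_colorings (join_K1_V V) (join_K1_E E) L
      = (\<Sum>c\<in>L None. num_L_colorings (Some ` V) (join_K1_E E)
          (\<lambda>x. if join_K1_E E None x then L x - {c} else L x))"
    unfolding join_K1_V_def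
    using assms by (intro num_L_colorings_insert) (auto simp: join_K1_E_def join_K1_V_def)
  then show ?thesis by (simp add: num_L_colorings_Some) (simp add: join_K1_E_def)
qed


subsection \<open>The join of a vertex and a theta graph\<close>

lemma theta_V_eq:
  "theta_V 2 2 n = insert End1 (insert End2 (insert (Inner 0 1) (insert (Inner 1 1) (Inner 2 ` {1..<n}))))"
proof -
  have "(i < 3 \<and> 1 \<le> j \<and> j < [2, 2, n] ! i) \<longleftrightarrow>
      (i = 0 \<and> j = 1) \<or> (i = 1 \<and> j = 1) \<or> (i = 2 \<and> j \<in> {1..<n})" for i j
    by (auto simp: less_Suc_eq numeral_2_eq_2 numeral_3_eq_3)
  then show ?thesis unfolding theta_V_def by auto
qed

lemma theta_E_sym: "theta_E l1 l2 l3 x y \<Longrightarrow> theta_E l1 l2 l3 y x"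
  unfolding theta_E_def by blast

lemma theta_E_iff:
  "theta_E 2 2 n x y \<longleftrightarrow> (\<exists>i<2. {x, y} = {End1, Inner i 1} \<or> {x, y} = {Inner i 1, End2}) \<or>
    (\<exists>j<n. {x, y} = {theta_pos [2, 2, n] 2 j, theta_pos [2, 2, n] 2 (Suc j)})"
proof -
  have three: "(\<exists>i<3. P i) \<longleftrightarrow> P 0 \<or> P 1 \<or> P 2" for P :: "nat \<Rightarrow> bool"
    by (auto simp: less_Suc_eq numeral_2_eq_2 numeral_3_eq_3)
  have two: "(\<exists>i<2. P i) \<longleftrightarrow> P 0 \<or> P 1" for P :: "nat \<Rightarrow> bool"
    by (auto simp: less_Suc_eq numeral_2_eq_2)
  have pos: "theta_pos [2, 2, n] i 0 = End1" "theta_pos [2, 2, n] 0 1 = Inner 0 1"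
    "theta_pos [2, 2, n] 1 1 = Inner 1 1" "theta_pos [2, 2, n] 0 2 = End2"
    "theta_pos [2, 2, n] 1 2 = End2" for i
    by (simp_all add: theta_pos_def)
  have nth: "[2, 2, n] ! 0 = 2" "[2, 2, n] ! 1 = 2" "[2, 2, n] ! 2 = n" by simp_all
  show ?thesis
    unfolding theta_E_def three nth two doubleton_eq_iff Suc_1 One_nat_def[symmetric] pos
    by blast
qed

lemma theta_pos_simps:
  assumes "n \<ge> 2" "j < n"
  shows "End1 = theta_pos [2, 2, n] 2 j \<longleftrightarrow> j = 0" "End2 \<noteq> theta_pos [2, 2, n] 2 j"
    "Inner i l = theta_pos [2, 2, n] 2 j \<longleftrightarrow> i = 2 \<and> j = l \<and> 1 \<le> l"
    "End1 \<noteq> theta_pos [2, 2, n] 2 (Suc j)" "End2 = theta_pos [2, 2, n] 2 (Suc j) \<longleftrightarrow> j = n - 1"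
    "Inner i l = theta_pos [2, 2, n] 2 (Suc j) \<longleftrightarrow> i = 2 \<and> Suc j = l \<and> l < n"
  using assms by (auto simp: theta_pos_def)

lemma theta_nbrs:
  assumes "n \<ge> 2"
  shows "\<not> theta_E 2 2 n x x"
    and "i < 2 \<Longrightarrow> theta_E 2 2 n End1 (Inner i 1)"
    and "\<not> theta_E 2 2 n End1 End2"
    and "theta_E 2 2 n End1 (Inner 2 j) \<longleftrightarrow> j = 1"
    and "i < 2 \<Longrightarrow> theta_E 2 2 n End2 (Inner i 1)"
    and "j < n \<Longrightarrow> 1 \<le> j \<Longrightarrow> theta_E 2 2 n End2 (Inner 2 j) \<longleftrightarrow> j = n - 1"
    and "\<not> theta_E 2 2 n (Inner 0 1) (Inner 1 1)"
    and "i < 2 \<Longrightarrow> \<not> theta_E 2 2 n (Inner i 1) (Inner 2 j)"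
    and "1 \<le> j \<Longrightarrow> j < l \<Longrightarrow> l < n \<Longrightarrow> theta_E 2 2 n (Inner 2 j) (Inner 2 l) \<longleftrightarrow> l = Suc j"
proof -
  note [simp] = theta_pos_simps[OF assms]
  show "\<not> theta_E 2 2 n x x"
    using assms by (auto simp: theta_E_iff doubleton_eq_iff theta_pos_def split: if_splits)
  show "i < 2 \<Longrightarrow> theta_E 2 2 n End1 (Inner i 1)"
    by (auto simp: theta_E_iff doubleton_eq_iff)
  show "\<not> theta_E 2 2 n End1 End2"
    using assms by (auto simp: theta_E_iff doubleton_eq_iff)
  show "theta_E 2 2 n End1 (Inner 2 j) \<longleftrightarrow> j = 1"
  proof
    assume "j = 1"
    then show "theta_E 2 2 n End1 (Inner 2 j)"
      using assms by (auto simp: theta_E_iff doubleton_eq_iff intro!: exI[of _ 0])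
  qed (use assms in \<open>auto simp: theta_E_iff doubleton_eq_iff\<close>)
  show "i < 2 \<Longrightarrow> theta_E 2 2 n End2 (Inner i 1)"
    by (auto simp: theta_E_iff doubleton_eq_iff)
  show "theta_E 2 2 n End2 (Inner 2 j) \<longleftrightarrow> j = n - 1" if "j < n" "1 \<le> j"
  proof
    assume "j = n - 1"
    then show "theta_E 2 2 n End2 (Inner 2 j)"
      using that assms by (auto simp: theta_E_iff doubleton_eq_iff theta_pos_def intro!: exI[of _ "n - 1"])
  qed (use assms that in \<open>auto simp: theta_E_iff doubleton_eq_iff\<close>)
  show "\<not> theta_E 2 2 n (Inner 0 1) (Inner 1 1)"
    by (auto simp: theta_E_iff doubleton_eq_iff)
  show "\<not> theta_E 2 2 n (Inner i 1) (Inner 2 j)" if "i < 2"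
    using that by (auto simp: theta_E_iff doubleton_eq_iff)
  show "theta_E 2 2 n (Inner 2 j) (Inner 2 l) \<longleftrightarrow> l = Suc j" if "1 \<le> j" "j < l" "l < n"
  proof
    assume "l = Suc j"
    then show "theta_E 2 2 n (Inner 2 j) (Inner 2 l)"
      using that by (auto simp: theta_E_iff doubleton_eq_iff intro!: exI[of _ j])
  qed (use that in \<open>auto simp: theta_E_iff doubleton_eq_iff\<close>)
qed

text \<open>The two deletions stand for the coloured neighbours of the first and the last vertex.
  They are separate differences because for \<open>i = n - 1\<close>, where the downward induction
  starts, both hit the same vertex.\<close>

lemma num_L_colorings_path:
  assumes n: "n \<ge> 2" and L: "\<And>j. 1 \<le> j \<Longrightarrow> j < n \<Longrightarrow> finite (L (Inner 2 j))" and i: "1 \<le> i" "i \<le> n - 1"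
  shows "num_L_colorings (Inner 2 ` {i..<n}) (theta_E 2 2 n)
      (\<lambda>u. L u - (if u = Inner 2 i then {a} else {}) - (if u = Inner 2 (n - 1) then {b} else {}))
    = path_count (map (\<lambda>j. L (Inner 2 j)) [i..<n]) a b"
  using i(2,1)
proof (induction i arbitrary: a rule: inc_induct)
  case base
  have "{n - 1..<n} = {n - 1}" "[n - 1..<n] = [n - 1]" using n by (auto simp: upt_rec)
  moreover have "L (Inner 2 (n - 1)) - {a} - {b} = L (Inner 2 (n - 1)) - {a, b}" by blast
  moreover have "num_L_colorings {v} (theta_E 2 2 n) M = card (M v)" if "finite (M v)" for v M
    using num_L_colorings_insert[of "{}" v "theta_E 2 2 n" M] that theta_E_sym theta_nbrs(1)[OF n] by simp
  ultimately show ?case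
    using n L[of "n - 1"] by (simp add: path_count_single del: path_count.simps)
next
  case (step i)
  let ?E = "theta_E 2 2 n"
  let ?M = "\<lambda>a i u. L u - (if u = Inner 2 i then {a} else {}) - (if u = Inner 2 (n - 1) then {b} else {})"
  have split: "Inner 2 ` {i..<n} = insert (Inner 2 i) (Inner 2 ` {Suc i..<n})"
    "[i..<n] = i # [Suc i..<n]"
    using step.hyps by (auto simp: upt_rec atLeastLessThan_def)
  have "num_L_colorings (Inner 2 ` {i..<n}) ?E (?M a i)
      = (\<Sum>c\<in>?M a i (Inner 2 i). num_L_colorings (Inner 2 ` {Suc i..<n}) ?E
          (\<lambda>u. if ?E (Inner 2 i) u then ?M a i u - {c} else ?M a i u))"
    unfolding split(1) using L theta_E_sym theta_nbrs(1)[OF n] step.hyps step.prems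
    by (intro num_L_colorings_insert) auto
  also have "\<dots> = (\<Sum>c\<in>L (Inner 2 i) - {a}. num_L_colorings (Inner 2 ` {Suc i..<n}) ?E (?M c (Suc i)))"
  proof (intro sum.cong num_L_colorings_cong)
    fix c u assume "u \<in> Inner 2 ` {Suc i..<n}"
    then obtain j where "u = Inner 2 j" "Suc i \<le> j" "j < n" by auto
    then show "(if ?E (Inner 2 i) u then ?M a i u - {c} else ?M a i u) = ?M c (Suc i) u"
      using theta_nbrs(9)[OF n, of i j] step.prems by auto
  qed (use step.hyps in auto)
  also have "\<dots> = path_count (map (\<lambda>j. L (Inner 2 j)) [i..<n]) a b"
    using step by (simp add: split(2))
  finally show ?case .
qed

text \<open>Once both ends are coloured, the interiors of the three paths do not interact, so the
  number of extensions is a product.\<close>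

lemma num_L_colorings_theta:
  assumes n: "n \<ge> 2" and L: "\<And>v. v \<in> theta_V 2 2 n \<Longrightarrow> finite (L v)"
  shows "num_L_colorings (theta_V 2 2 n) (theta_E 2 2 n) L
    = theta_count (L End1) (L End2) (L (Inner 0 1)) (L (Inner 1 1))
        (path_count (map (\<lambda>j. L (Inner 2 j)) [1..<n]))"
proof -
  let ?E = "theta_E 2 2 n" and ?W = "Inner 2 ` {1..<n}"
  let ?V2 = "insert (Inner 1 1) ?W"
  let ?V1 = "insert (Inner 0 1) ?V2"
  let ?M1 = "\<lambda>a u. if ?E End1 u then L u - {a} else L u"
  let ?M2 = "\<lambda>a b u. if ?E End2 u then ?M1 a u - {b} else ?M1 a u"
  have fin: "finite (L End1)" "finite (L End2)" "finite (L (Inner 0 1))" "finite (L (Inner 1 1))"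
    "\<And>j. 1 \<le> j \<Longrightarrow> j < n \<Longrightarrow> finite (L (Inner 2 j))"
    using L unfolding theta_V_eq by auto
  note ins = num_L_colorings_insert[where E = ?E, OF _ _ theta_E_sym theta_nbrs(1)[OF n]]
  have inner: "num_L_colorings ?V1 ?E (?M2 a b)
      = card (L (Inner 0 1) - {a, b}) * card (L (Inner 1 1) - {a, b})
        * path_count (map (\<lambda>j. L (Inner 2 j)) [1..<n]) a b" for a b
  proof -
    have M: "?M2 a b (Inner i 1) = L (Inner i 1) - {a, b}" if "i < 2" for i
      using theta_nbrs(2,5)[OF n that] by auto
    have "num_L_colorings ?V1 ?E (?M2 a b)
        = (\<Sum>c\<in>?M2 a b (Inner 0 1). num_L_colorings ?V2 ?E
            (\<lambda>u. if ?E (Inner 0 1) u then ?M2 a b u - {c} else ?M2 a b u))"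
      using fin by (intro ins) auto
    also have "\<dots> = (\<Sum>c\<in>?M2 a b (Inner 0 1). num_L_colorings ?V2 ?E (?M2 a b))"
      using theta_nbrs(7)[OF n] theta_nbrs(8)[OF n, of 0]
      by (intro sum.cong num_L_colorings_cong) auto
    also have "num_L_colorings ?V2 ?E (?M2 a b)
        = (\<Sum>c\<in>?M2 a b (Inner 1 1). num_L_colorings ?W ?E
            (\<lambda>u. if ?E (Inner 1 1) u then ?M2 a b u - {c} else ?M2 a b u))"
      using fin by (intro ins) auto
    also have "\<dots> = (\<Sum>c\<in>?M2 a b (Inner 1 1). num_L_colorings ?W ?E (?M2 a b))"
      using theta_nbrs(8)[OF n, of 1]
      by (intro sum.cong num_L_colorings_cong) auto
    also have "num_L_colorings ?W ?E (?M2 a b) = num_L_colorings ?W ?E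
      (\<lambda>u. L u - (if u = Inner 2 1 then {a} else {}) - (if u = Inner 2 (n - 1) then {b} else {}))"
    proof (rule num_L_colorings_cong)
      fix u assume "u \<in> ?W"
      then obtain j where "u = Inner 2 j" "1 \<le> j" "j < n" by auto
      then show "?M2 a b u = L u - (if u = Inner 2 1 then {a} else {}) - (if u = Inner 2 (n - 1) then {b} else {})"
        using theta_nbrs(4)[OF n, of j] theta_nbrs(6)[OF n, of j] by auto
    qed
    also have "\<dots> = path_count (map (\<lambda>j. L (Inner 2 j)) [1..<n]) a b"
      using n fin(5) by (intro num_L_colorings_path) auto
    finally show ?thesis using M[of 0] M[of 1] by (simp add: mult.assoc)
  qed
  have "num_L_colorings (theta_V 2 2 n) ?E L
      = (\<Sum>a\<in>L End1. num_L_colorings (insert End2 ?V1) ?E (?M1 a))"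
    unfolding theta_V_eq using fin by (intro ins) auto
  also have "\<dots> = (\<Sum>a\<in>L End1. \<Sum>b\<in>?M1 a End2. num_L_colorings ?V1 ?E (?M2 a b))"
    using fin by (intro sum.cong ins) auto
  also have "\<dots> = (\<Sum>a\<in>L End1. \<Sum>b\<in>L End2. num_L_colorings ?V1 ?E (?M2 a b))"
    using theta_nbrs(3)[OF n] by simp
  finally show ?thesis unfolding theta_count_def inner .
qed


section \<open>Bounds for the theta graph and for its join with a vertex\<close>

lemma q_lists_theta:
  assumes "\<forall>v\<in>theta_V 2 2 n. finite (L v) \<and> card (L v) = q"
  shows "q_lists q (L End1 # L End2 # L (Inner 0 1) # L (Inner 1 1) # map (\<lambda>j. L (Inner 2 j)) [1..<n])"
  using assms unfolding theta_V_eq by (auto simp: q_lists_def)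

lemma finite_theta_V: "finite (theta_V 2 2 n)"
  by (simp add: theta_V_eq)

lemma num_L_colorings_theta_ge:
  assumes "k \<ge> 1" "r \<ge> 1" "\<forall>v\<in>theta_V 2 2 (2 * k). finite (L v) \<and> r + 2 \<le> card (L v)"
  shows "theta_poly r k \<le> num_L_colorings (theta_V 2 2 (2 * k)) (theta_E 2 2 (2 * k)) L"
  using finite_theta_V _ assms(3)
proof (rule num_L_colorings_ge_if_ge_sublists)
  fix L :: "theta_vertex \<Rightarrow> nat set"
  assume L: "\<forall>v\<in>theta_V 2 2 (2 * k). finite (L v) \<and> card (L v) = r + 2"
  show "theta_poly r k \<le> num_L_colorings (theta_V 2 2 (2 * k)) (theta_E 2 2 (2 * k)) L"
    using theta_count_ge[OF q_lists_theta[OF L] _ assms(2), of k] assms(1) L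
    by (subst num_L_colorings_theta) auto
qed

lemma num_L_colorings_theta_const:
  assumes "k \<ge> 1" "finite S" "card S = r + 2"
  shows "num_L_colorings (theta_V 2 2 (2 * k)) (theta_E 2 2 (2 * k)) (\<lambda>_. S) = theta_poly r k"
  using assms theta_count_const[OF assms(2,3,1)]
  by (subst num_L_colorings_theta) (auto simp: map_replicate_const)

lemma num_L_colorings_theta_const_eq_0:
  assumes "k \<ge> 1" "finite S" "card S \<le> 1"
  shows "num_L_colorings (theta_V 2 2 (2 * k)) (theta_E 2 2 (2 * k)) (\<lambda>_. S) = 0"
proof -
  have "S - {a, b} = {}" if "a \<in> S" for a b
    using assms(2,3) that by (auto simp: card_le_Suc0_iff_eq)
  then show ?thesis
    using assms by (subst num_L_colorings_theta) (auto simp: theta_count_def)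
qed

text \<open>The dominating vertex takes one of the \<open>m\<close> colours and leaves
  \<open>m - 1 = r + 2\<close>, hence \<open>r = m - 3\<close>. For \<open>m \<le> 2\<close>
  truncated subtraction would yield the value for two colours, so that case is separate.\<close>

lemma chrom_poly_join_theta:
  assumes "k \<ge> 1"
  shows "chrom_poly (join_K1_V (theta_V 2 2 (2 * k))) (join_K1_E (theta_E 2 2 (2 * k))) m
    = (if m \<le> 2 then 0 else m * theta_poly (m - 3) k)"
proof -
  let ?n = "\<lambda>c. num_L_colorings (theta_V 2 2 (2 * k)) (theta_E 2 2 (2 * k)) (\<lambda>_. {0..<m} - {c})"
  have "chrom_poly (join_K1_V (theta_V 2 2 (2 * k))) (join_K1_E (theta_E 2 2 (2 * k))) m = (\<Sum>c<m. ?n c)"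
    unfolding chrom_poly_def using finite_theta_V theta_E_sym
    by (subst num_L_colorings_join_K1) (auto simp: atLeast0LessThan)
  also have "\<dots> = (\<Sum>c<m. if m \<le> 2 then 0 else theta_poly (m - 3) k)"
  proof (rule sum.cong)
    fix c assume "c \<in> {..<m}"
    then have "card ({0..<m} - {c}) = m - 1" by simp
    then show "?n c = (if m \<le> 2 then 0 else theta_poly (m - 3) k)"
      using num_L_colorings_theta_const[OF assms, of "{0..<m} - {c}" "m - 3"]
        num_L_colorings_theta_const_eq_0[OF assms, of "{0..<m} - {c}"] by auto
  qed simp
  finally show ?thesis by simp
qed

text \<open>In the tight shape \<open>y\<close> is the only colour common to both end lists, and
  \<open>x\<close> the only one common to both middle lists.\<close>

lemma tight_missing_colours:
  assumes "tight A B L M N"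
  obtains x y where "N y y = 0" "x \<notin> A \<or> x \<notin> B" "y \<notin> L \<or> y \<notin> M"
    "\<And>c. c \<noteq> x \<Longrightarrow> c \<noteq> y \<Longrightarrow> (c \<notin> A \<or> c \<notin> B) \<and> (c \<notin> L \<or> c \<notin> M)"
proof -
  obtain x y z where xyz: "x \<noteq> y" "y \<noteq> z" "x \<noteq> z" and AB: "{A, B} = {{x, y}, {y, z}}"
    and LM: "{L, M} = {{x, y}, {x, z}}" and N: "N y y = 0"
    using assms unfolding tight_def by (elim exE conjE) (rule that)
  have "c \<notin> A \<or> c \<notin> B \<longleftrightarrow> (\<exists>X\<in>{A, B}. c \<notin> X)" "c \<notin> L \<or> c \<notin> M \<longleftrightarrow> (\<exists>X\<in>{L, M}. c \<notin> X)" for c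
    by auto
  then have miss: "c \<notin> A \<or> c \<notin> B \<longleftrightarrow> c \<noteq> y" "c \<notin> L \<or> c \<notin> M \<longleftrightarrow> c \<noteq> x" for c
    unfolding AB LM using xyz by auto
  show ?thesis by (rule that[OF N, of x]) (use miss xyz in auto)
qed

text \<open>A single colouring forces the tight shape. Colours other than \<open>x\<close> and
  \<open>y\<close> are missing at an end and at a middle vertex, and \<open>x\<close> is missing at
  an end. The colour \<open>y\<close> is missing at a middle vertex and, since the long path admits
  no colouring with \<open>y\<close> at both ends, also from some list on that path.\<close>

lemma num_L_colorings_theta_two:
  assumes k: "k \<ge> 1" and L: "\<forall>v\<in>theta_V 2 2 (2 * k). finite (L v) \<and> card (L v) = 2"
  shows "1 \<le> num_L_colorings (theta_V 2 2 (2 * k)) (theta_E 2 2 (2 * k)) L"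
    and "num_L_colorings (theta_V 2 2 (2 * k)) (theta_E 2 2 (2 * k)) L < 2 \<Longrightarrow>
      \<exists>x. \<forall>c. (\<exists>u\<in>theta_V 2 2 (2 * k). c \<notin> L u) \<and>
        (c \<noteq> x \<longrightarrow> (\<exists>u\<in>theta_V 2 2 (2 * k). \<exists>w\<in>theta_V 2 2 (2 * k). u \<noteq> w \<and> c \<notin> L u \<and> c \<notin> L w))"
proof -
  let ?Vs = "map (\<lambda>j. L (Inner 2 j)) [1..<2 * k]"
  let ?T = "theta_count (L End1) (L End2) (L (Inner 0 1)) (L (Inner 1 1)) (path_count ?Vs)"
  have ql: "q_lists 2 ?Vs" and len: "length ?Vs + 1 = 2 * k"
    using q_lists_theta[OF L] k by auto
  have num: "num_L_colorings (theta_V 2 2 (2 * k)) (theta_E 2 2 (2 * k)) L = ?T"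
    using k L by (intro num_L_colorings_theta) auto
  have T: "1 \<le> ?T \<and> (2 \<le> ?T \<or> tight (L End1) (L End2) (L (Inner 0 1)) (L (Inner 1 1)) (path_count ?Vs))"
    using q_lists_theta[OF L] by (intro theta_count_two_lists[OF blocking_path_count[OF ql len]]) auto
  then show "1 \<le> num_L_colorings (theta_V 2 2 (2 * k)) (theta_E 2 2 (2 * k)) L" by (simp add: num)
  assume "num_L_colorings (theta_V 2 2 (2 * k)) (theta_E 2 2 (2 * k)) L < 2"
  then have "tight (L End1) (L End2) (L (Inner 0 1)) (L (Inner 1 1)) (path_count ?Vs)"
    using T num by simp
  then obtain x y where N: "path_count ?Vs y y = 0" and x: "x \<notin> L End1 \<or> x \<notin> L End2"
    and y: "y \<notin> L (Inner 0 1) \<or> y \<notin> L (Inner 1 1)"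
    and oth: "\<And>c. c \<noteq> x \<Longrightarrow> c \<noteq> y \<Longrightarrow>
      (c \<notin> L End1 \<or> c \<notin> L End2) \<and> (c \<notin> L (Inner 0 1) \<or> c \<notin> L (Inner 1 1))"
    by (rule tight_missing_colours) blast
  have "\<not> (\<forall>V\<in>set ?Vs. y \<in> V)" using path_count_common_colour[OF ql len, of y] N by auto
  then obtain j where j: "1 \<le> j" "j < 2 * k" "y \<notin> L (Inner 2 j)" by auto
  have mem: "End1 \<in> theta_V 2 2 (2 * k)" "End2 \<in> theta_V 2 2 (2 * k)"
    "Inner 0 1 \<in> theta_V 2 2 (2 * k)" "Inner 1 1 \<in> theta_V 2 2 (2 * k)" "Inner 2 j \<in> theta_V 2 2 (2 * k)"
    using j by (auto simp: theta_V_eq)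
  have lt2: "0 < (2 :: nat)" "1 < (2 :: nat)" by simp_all
  have two: "\<exists>u\<in>theta_V 2 2 (2 * k). \<exists>w\<in>theta_V 2 2 (2 * k). u \<noteq> w \<and> c \<notin> L u \<and> c \<notin> L w"
    if cx: "c \<noteq> x" for c
  proof (cases "c = y")
    case True
    obtain i where "i < 2" "y \<notin> L (Inner i 1)" using y lt2 by blast
    then have "Inner i 1 \<noteq> Inner 2 j" "Inner i 1 \<in> theta_V 2 2 (2 * k)"
      using mem by (auto simp: less_2_cases_iff)
    then show ?thesis using True j(3) mem(5) \<open>y \<notin> L (Inner i 1)\<close> by blast
  next
    case False
    obtain i where "i < 2" "c \<notin> L (Inner i 1)" 
      using oth[OF cx False] lt2 by blast
    then have "Inner i 1 \<in> theta_V 2 2 (2 * k)" using mem by (auto simp: less_2_cases_iff)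
    moreover obtain u where "u = End1 \<or> u = End2" "c \<notin> L u" using oth[OF cx False] by blast
    ultimately have "u \<in> theta_V 2 2 (2 * k) \<and> u \<noteq> Inner i 1" using mem by auto
    then show ?thesis using \<open>Inner i 1 \<in> _\<close> \<open>c \<notin> L u\<close> \<open>c \<notin> L (Inner i 1)\<close> by blast
  qed
  have "\<exists>u\<in>theta_V 2 2 (2 * k). c \<notin> L u" for c
    using two[of c] x mem(1,2) by blast
  then show "\<exists>x. \<forall>c. (\<exists>u\<in>theta_V 2 2 (2 * k). c \<notin> L u) \<and>
        (c \<noteq> x \<longrightarrow> (\<exists>u\<in>theta_V 2 2 (2 * k). \<exists>w\<in>theta_V 2 2 (2 * k). u \<noteq> w \<and> c \<notin> L u \<and> c \<notin> L w))"
    using two by blast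
qed

lemma num_L_colorings_join_theta_three:
  assumes k: "k \<ge> 1" and L: "\<forall>v\<in>join_K1_V (theta_V 2 2 (2 * k)). finite (L v) \<and> card (L v) = 3"
  shows "6 \<le> num_L_colorings (join_K1_V (theta_V 2 2 (2 * k))) (join_K1_E (theta_E 2 2 (2 * k))) L"
proof -
  let ?V = "theta_V 2 2 (2 * k)" and ?E = "theta_E 2 2 (2 * k)"
  define P where "P c = num_L_colorings ?V ?E (\<lambda>v. L (Some v) - {c})" for c
  have num: "num_L_colorings (join_K1_V ?V) (join_K1_E ?E) L = (\<Sum>c\<in>L None. P c)"
    unfolding P_def using L finite_theta_V theta_E_sym by (intro num_L_colorings_join_K1) auto
  have LS: "finite (L (Some v))" "card (L (Some v)) = 3" if "v \<in> ?V" for v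
    using L that by (auto simp: join_K1_V_def)
  have L0: "finite (L None)" "card (L None) = 3" using L by (auto simp: join_K1_V_def)
  have surplus: "card S + 1 \<le> P c" if "S \<subseteq> ?V" "\<forall>v\<in>S. c \<notin> L (Some v)" for S c
    unfolding P_def
  proof (rule num_L_colorings_surplus[OF finite_theta_V num_L_colorings_theta_two(1)[OF k]])
    show "\<forall>v\<in>?V. finite (L (Some v) - {c}) \<and> 2 \<le> card (L (Some v) - {c})"
      using LS by (auto simp: card_Diff_singleton_if)
    show "\<forall>v\<in>S. 2 < card (L (Some v) - {c})"
      using that LS by (auto simp: card_Diff_singleton_if)
  qed (use that in auto)
  show ?thesis
  proof (cases "\<forall>c\<in>L None. 2 \<le> P c")
    case True
    then have "(\<Sum>c\<in>L None. 2) \<le> (\<Sum>c\<in>L None. P c)" by (intro sum_mono) auto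
    then show ?thesis using L0 num by simp
  next
    case False
    then obtain c0 where c0: "c0 \<in> L None" "P c0 < 2" by auto
    \<comment> \<open>A vertex whose list lacks \<open>c0\<close> would keep three colours and yield
      a second colouring. So all reduced lists have size exactly two.\<close>
    have in_all: "c0 \<in> L (Some v)" if "v \<in> ?V" for v
      using surplus[of "{v}" c0] that c0(2) by auto
    then have "\<forall>v\<in>?V. finite (L (Some v) - {c0}) \<and> card (L (Some v) - {c0}) = 2"
      using LS by simp
    from num_L_colorings_theta_two(2)[OF k this] c0(2)
    obtain x where x: "\<And>c. (\<exists>u\<in>?V. c \<notin> L (Some u) - {c0})"
        "\<And>c. c \<noteq> x \<Longrightarrow> \<exists>u\<in>?V. \<exists>w\<in>?V. u \<noteq> w \<and> c \<notin> L (Some u) - {c0} \<and> c \<notin> L (Some w) - {c0}"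
      unfolding P_def by blast
    \<comment> \<open>For \<open>c \<noteq> c0\<close>, absence from a reduced list means absence
      from the original list, which then keeps size three after deleting \<open>c\<close>.\<close>
    have two: "2 \<le> P c" if c: "c \<noteq> c0" for c
    proof -
      obtain u where "u \<in> ?V" "c \<notin> L (Some u)" using x(1)[of c] c by auto
      then show ?thesis using surplus[of "{u}" c] by simp
    qed
    have three: "3 \<le> P c" if c: "c \<noteq> c0" "c \<noteq> x" for c
    proof -
      obtain u w where "u \<in> ?V" "w \<in> ?V" "u \<noteq> w" "c \<notin> L (Some u)" "c \<notin> L (Some w)"
        using x(2)[of c] c by auto
      then show ?thesis using surplus[of "{u, w}" c] by simp
    qed
    have "card (L None - {c0}) = 2" using c0 L0 by simp
    then obtain c1 c2 where c12: "L None - {c0} = {c1, c2}" "c1 \<noteq> c2" by (auto simp: card_2_iff)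
    then have "c1 \<noteq> c0" "c2 \<noteq> c0" by auto
    \<comment> \<open>At most one of \<open>c1\<close>, \<open>c2\<close> is the exceptional colour
      \<open>x\<close>, so the contributions are at least 2 and 3.\<close>
    then have "5 \<le> P c1 + P c2"
      using two[of c1] two[of c2] three[of c1] three[of c2] c12(2) by (cases "c1 = x") auto
    moreover have "1 \<le> P c0" using surplus[of "{}" c0] by simp
    moreover have "(\<Sum>c\<in>L None. P c) = P c0 + (P c1 + P c2)"
      using sum.remove[OF L0(1) c0(1), of P] c12 by simp
    ultimately show ?thesis using num by simp
  qed
qed

lemma chrom_poly_join_theta_le:
  assumes k: "k \<ge> 1" and L: "\<forall>v\<in>join_K1_V (theta_V 2 2 (2 * k)). finite (L v) \<and> card (L v) = m"
  shows "chrom_poly (join_K1_V (theta_V 2 2 (2 * k))) (join_K1_E (theta_E 2 2 (2 * k))) m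
    \<le> num_L_colorings (join_K1_V (theta_V 2 2 (2 * k))) (join_K1_E (theta_E 2 2 (2 * k))) L"
proof -
  let ?V = "theta_V 2 2 (2 * k)" and ?E = "theta_E 2 2 (2 * k)"
  have "m \<le> 2 \<or> m = 3 \<or> (\<exists>r\<ge>1. m = r + 3)" by presburger
  then consider "m \<le> 2" | "m = 3" | r where "m = r + 3" "r \<ge> 1" by blast
  then show ?thesis
  proof cases
    case 1
    then show ?thesis by (simp add: chrom_poly_join_theta[OF k])
  next
    case 2
    \<comment> \<open>For \<open>m = 3\<close> the target value is
      \<open>3 * theta_poly 0 k = 6\<close>.\<close>
    have "even_path_poly 0 k = 0" using even_path_poly_eq[of 0 k] by simp
    then have "theta_poly 0 k = 2" by (simp add: theta_poly_def)
    then show ?thesis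
      using num_L_colorings_join_theta_three[OF k] L 2 by (simp add: chrom_poly_join_theta[OF k])
  next
    case 3
    have "theta_poly r k \<le> num_L_colorings ?V ?E (\<lambda>v. L (Some v) - {c})" for c
      using L 3(1) by (intro num_L_colorings_theta_ge[OF k 3(2)])
        (auto simp: join_K1_V_def card_Diff_singleton_if)
    then have "(\<Sum>c\<in>L None. theta_poly r k) \<le> (\<Sum>c\<in>L None. num_L_colorings ?V ?E (\<lambda>v. L (Some v) - {c}))"
      by (intro sum_mono)
    also have "\<dots> = num_L_colorings (join_K1_V ?V) (join_K1_E ?E) L"
      using L finite_theta_V theta_E_sym by (intro num_L_colorings_join_K1[symmetric]) auto
    finally have "card (L None) * theta_poly r k \<le> num_L_colorings (join_K1_V ?V) (join_K1_E ?E) L"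
      by simp
    moreover have "card (L None) = r + 3" using L 3(1) by (simp add: join_K1_V_def)
    ultimately show ?thesis using 3(1) by (simp add: chrom_poly_join_theta[OF k])
  qed
qed

theorem theorem28:
  fixes k :: nat
  assumes "k \<ge> 1"
  shows "enum_chrom_choosable (join_K1_V (theta_V 2 2 (2 * k))) (join_K1_E (theta_E 2 2 (2 * k)))"
  unfolding enum_chrom_choosable_def
proof (intro allI impI)
  fix m :: nat
  let ?V = "join_K1_V (theta_V 2 2 (2 * k))" and ?E = "join_K1_E (theta_E 2 2 (2 * k))"
  let ?S = "{num_L_colorings ?V ?E L | L. \<forall>v\<in>?V. finite (L v) \<and> card (L v) = m}"
  \<comment> \<open>Constant lists are an admissible assignment, so the value is attained; this also
    makes \<open>?S\<close> nonempty, as the lower bound on \<open>Inf ?S\<close> requires.\<close>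
  have mem: "chrom_poly ?V ?E m \<in> ?S"
    unfolding chrom_poly_def by (intro CollectI exI[of _ "\<lambda>_. {0..<m}"]) simp
  show "list_color_fn ?V ?E m = chrom_poly ?V ?E m"
    unfolding list_color_fn_def
  proof (rule antisym)
    show "Inf ?S \<le> chrom_poly ?V ?E m" using mem by (intro cInf_lower) auto
    show "chrom_poly ?V ?E m \<le> Inf ?S"
      using mem chrom_poly_join_theta_le[OF assms] by (intro cInf_greatest) auto
  qed
qed

end
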